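(* Let $U\in\mathbb{R}^{n\times d}$ be a matrix of rank $d$, let $C\in{\rm Ch}(U)$ be an $n$-dimensional cone of its chamber complex, and let $\Sigma=\Sigma_C$ be the common normal fan of the polyhedra $P_z$, $z\in{\rm int}(C)$; assume that $U=U_C$, i.e. that $U$ is a ray matrix of $\Sigma$. For any $z\in{\rm int}(C)$, we have ${\rm Adj}_\Sigma(U\,y+z)={\rm adj}_{P_z}(y)$ in $\mathbb{R}[y_1,\ldots,y_d]$.
   Context: For $x\in\mathbb{R}^n$, $P_x=\{y\in\mathbb{R}^d:Uy+x\ge0\}$. Chamber complex: for $I\subseteq\{1,\dots,n\}$ let $\tilde C_I\subseteq\mathbb{R}^n$ be the cone generated by the standard basis vectors $e_i$, $i\in I$, and $C_I=\tilde C_I+{\rm im}(U)$, with ${\rm im}(U)$ the column span of $U$. For $x\in\mathbb{R}^n$, $C_x$ is the intersection of all $C_I$ containing $x$ ($\emptyset$ if there are none). ${\rm Ch}(U)=\{C_x:x\in\mathbb{R}^n\}$ is a fan in $\mathbb{R}^n$, and for each cone $C\in{\rm Ch}(U)$ all polyhedra $P_x$ with $x\in{\rm relint}(C)$ have the same (inner) normal fan, denoted $\Sigma_C$; its rays are generated by some of the rows of $U$, and $U_C$ is the submatrix of $U$ of those rows. If $\dim C=n$, then for $x\in{\rm int}(C)$ the polyhedron $P_x$ (possibly unbounded) is $d$-dimensional and simple, and $\Sigma_C$ is simplicial. $\Sigma(d)$ is the set of $d$-dimensional cones of $\Sigma$, $\sigma(1)$ the set of rays of $\sigma$, and $U_\sigma$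 the submatrix of $U$ with rows indexed by $\sigma(1)$ (rows $u_1,\dots,u_n$ of $U$ are identified with rays of $\Sigma$). The universal adjoint is ${\rm Adj}_\Sigma(x)=\sum_{\sigma\in\Sigma(d)}|\det U_\sigma|\prod_{\rho\notin\sigma(1)}x_\rho$. The adjoint polynomial ${\rm adj}_{P_z}(y)$ is defined by $${\rm Vol}\big((P_z-y)^\circ\big)=\frac{{\rm adj}_{P_z}(y)}{(u_1\cdot y+z_1)(u_2\cdot y+z_2)\cdots(u_n\cdot y+z_n)}\qquad\text{for }y\in{\rm int}(P_z),$$ where $P_z-y=\{y'-y:y'\in P_z\}$, $K^\circ=\{u\in(\mathbb{R}^d)^\vee:u\cdot y'\ge-1\text{ for all }y'\in K\}$ is the polar dual, and ${\rm Vol}$ is normalized volume, i.e. $d!$ times Lebesgue measure. *)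

theory Defs
  imports "HOL-Analysis.Analysis"
begin

text \<open>Dual vectors are identified with vectors via the standard inner product; the rows
  \<open>u\<^sub>i = row i U\<close> of \<open>U\<close> are thus elements of \<open>real ^ 'd\<close>.\<close>

definition polyhedron_of :: "real ^ 'd ^ 'n \<Rightarrow> real ^ 'n \<Rightarrow> (real ^ 'd) set" where
  "polyhedron_of U x = {y. \<forall>i. 0 \<le> (U *v y + x) $ i}"

section \<open>Chamber complex\<close>

definition cone_of :: "real ^ 'd ^ 'n \<Rightarrow> 'n set \<Rightarrow> (real ^ 'n) set" where
  "cone_of U I = {a + b | a b. a \<in> convex_cone hull ((\<lambda>i. axis i 1) ` I) \<and> b \<in> range ((*v) U)}"

text \<open>The case distinction is needed because \<open>\<Inter>{} = UNIV\<close>.\<close>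

definition chamber :: "real ^ 'd ^ 'n \<Rightarrow> real ^ 'n \<Rightarrow> (real ^ 'n) set" where
  "chamber U x = (if \<exists>I. x \<in> cone_of U I then \<Inter>{cone_of U I | I. x \<in> cone_of U I} else {})"

definition chamber_complex :: "real ^ 'd ^ 'n \<Rightarrow> (real ^ 'n) set set" where
  "chamber_complex U = range (chamber U)"

section \<open>Normal fans\<close>

definition inner_normal_cone :: "(real ^ 'd) set \<Rightarrow> (real ^ 'd) set \<Rightarrow> (real ^ 'd) set" where
  "inner_normal_cone P F = {u. \<forall>y\<in>F. \<forall>y'\<in>P. u \<bullet> y \<le> u \<bullet> y'}"

definition normal_fan :: "(real ^ 'd) set \<Rightarrow> (real ^ 'd) set set" where
  "normal_fan P = {inner_normal_cone P F | F. F face_of P \<and> F \<noteq> {}}"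

text \<open>The fan \<open>\<Sigma>\<^sub>C\<close>. The description is proper for every nonempty \<open>C\<close> in the chamber complex,
  since all polyhedra \<open>P\<^sub>x\<close> with \<open>x\<close> in the relative interior of \<open>C\<close> have the same normal fan.\<close>

definition fan_of_chamber :: "real ^ 'd ^ 'n \<Rightarrow> (real ^ 'n) set \<Rightarrow> (real ^ 'd) set set" where
  "fan_of_chamber U C = (THE \<Sigma>. \<forall>x\<in>rel_interior C. normal_fan (polyhedron_of U x) = \<Sigma>)"

text \<open>\<open>cones_of_dim k \<Sigma>\<close> is \<open>\<Sigma>(k)\<close>; for a cone the dimension of the linear span is its dimension.\<close>

definition cones_of_dim :: "nat \<Rightarrow> (real ^ 'd) set set \<Rightarrow> (real ^ 'd) set set" where
  "cones_of_dim k \<Sigma> = {\<sigma> \<in> \<Sigma>. dim \<sigma> = k}"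

definition row_ray :: "real ^ 'd ^ 'n \<Rightarrow> 'n \<Rightarrow> (real ^ 'd) set" where
  "row_ray U i = convex_cone hull {row i U}"

text \<open>\<open>U\<close> is a ray matrix of \<open>\<Sigma>\<close>: its rows generate the rays of \<open>\<Sigma>\<close>, one row for each ray.
  For \<open>\<Sigma> = \<Sigma>\<^sub>C\<close> this is the condition \<open>U = U\<^sub>C\<close>.\<close>

definition ray_matrix :: "real ^ 'd ^ 'n \<Rightarrow> (real ^ 'd) set set \<Rightarrow> bool" where
  "ray_matrix U \<Sigma> \<longleftrightarrow> bij_betw (row_ray U) UNIV (cones_of_dim 1 \<Sigma>)"

definition rays_of_cone :: "(real ^ 'd) set \<Rightarrow> (real ^ 'd) set set" where
  "rays_of_cone \<sigma> = {\<rho>. \<rho> face_of \<sigma> \<and> dim \<rho> = 1}"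

text \<open>The rays of \<open>\<sigma>\<close>, identified with row indices of a ray matrix \<open>U\<close>.\<close>

definition ray_indices :: "real ^ 'd ^ 'n \<Rightarrow> (real ^ 'd) set \<Rightarrow> 'n set" where
  "ray_indices U \<sigma> = {i. row_ray U i \<in> rays_of_cone \<sigma>}"

section \<open>Universal adjoint and adjoint polynomial\<close>

text \<open>\<open>|det U\<^sub>I|\<close> for the submatrix of rows indexed by a set \<open>I\<close> with \<open>card I = CARD('d)\<close>. The
  rows are listed in an arbitrary order, which does not affect the absolute value. In a simplicial
  fan with ray matrix \<open>U\<close>, a full-dimensional cone has exactly \<open>CARD('d)\<close> rays.\<close>

definition abs_det_rows :: "real ^ 'd ^ 'n \<Rightarrow> 'n set \<Rightarrow> real" where
  "abs_det_rows U I =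
     \<bar>det ((\<chi> k. row ((SOME f :: 'd \<Rightarrow> 'n. bij_betw f UNIV I) k) U) :: real ^ 'd ^ 'd)\<bar>"

definition universal_adjoint :: "real ^ 'd ^ 'n \<Rightarrow> (real ^ 'd) set set \<Rightarrow> real ^ 'n \<Rightarrow> real" where
  "universal_adjoint U \<Sigma> x =
     (\<Sum>\<sigma>\<in>cones_of_dim CARD('d) \<Sigma>.
        abs_det_rows U (ray_indices U \<sigma>) * (\<Prod>i\<in>- ray_indices U \<sigma>. x $ i))"

definition polar_dual :: "(real ^ 'd) set \<Rightarrow> (real ^ 'd) set" where
  "polar_dual K = {u. \<forall>y\<in>K. u \<bullet> y \<ge> -1}"

definition normalized_volume :: "(real ^ 'd) set \<Rightarrow> real" where
  "normalized_volume S = fact CARD('d) * measure lebesgue S"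

text \<open>Polynomials in \<open>\<real>[y\<^sub>1, \<dots>, y\<^sub>d]\<close> are represented by the polynomial functions they define on
  \<open>real ^ 'd\<close>; since \<open>\<real>\<close> is infinite, nothing is lost. A polynomial with the property below is
  unique whenever \<open>P\<^sub>z\<close> has nonempty interior.\<close>

definition adjoint_polynomial :: "real ^ 'd ^ 'n \<Rightarrow> real ^ 'n \<Rightarrow> real ^ 'd \<Rightarrow> real" where
  "adjoint_polynomial U z =
     (THE p. real_polynomial_function p \<and>
        (\<forall>y\<in>interior (polyhedron_of U z).
           normalized_volume (polar_dual {y' - y | y'. y' \<in> polyhedron_of U z}) =
             p y / (\<Prod>i\<in>UNIV. row i U \<bullet> y + z $ i)))"

end

theory Submission
  imports Defs
begin

text \<open>Encode the combinatorial type of \<open>P\<^sub>x\<close> by the sets \<open>J\<close> of constraints that are tight at its vertices.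
  A point \<open>x\<close> lies in \<open>C\<^sub>I\<close> iff some point of \<open>P\<^sub>x\<close> satisfies all constraints outside \<open>I\<close> with equality, so
  perturbing \<open>x\<close> inside a full-dimensional chamber shows that each such \<open>J\<close> indexes a basis of rows and
  that the collection of these \<open>J\<close> is constant on the interior of the chamber. By Farkas' lemma the
  cones of the normal fan are the cones spanned by the rows in the subsets of these \<open>J\<close>, the
  full-dimensional ones being those of the \<open>J\<close> themselves. The simplicial fan cuts the polar dual of
  \<open>P\<^sub>z - y\<close> into the simplices with vertices \<open>0\<close> and \<open>u\<^sub>j / (u\<^sub>j \<cdot> y + z\<^sub>j)\<close>, \<open>j \<in> J\<close>, of normalized volume
  \<open>|det U\<^sub>J| / \<Prod>\<^sub>j (u\<^sub>j \<cdot> y + z\<^sub>j)\<close>; adding up gives the universal adjoint over the product of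
  all \<open>u\<^sub>i \<cdot> y + z\<^sub>i\<close>.\<close>

section \<open>Vertices and normal fans of polyhedra\<close>

lemma convex_cone_hull_finite_image:
  assumes "finite J"
  shows "convex_cone hull (f ` J) = {\<Sum>j\<in>J. c j *\<^sub>R f j | c. \<forall>j\<in>J. (0::real) \<le> c j}" (is "_ = ?R")
proof
  have "f j \<in> ?R" if "j \<in> J" for j
  proof -
    have "f j = (\<Sum>k\<in>J. (if k = j then 1 else 0) *\<^sub>R f k)"
      using assms that by (simp add: if_distrib [of "\<lambda>r. r *\<^sub>R _"] cong: if_cong)
    then show ?thesis by force
  qed
  moreover have "convex_cone ?R"
    unfolding convex_cone_iff
  proof (intro conjI ballI allI impI)
    show "0 \<in> ?R" by (force intro!: exI [of _ "\<lambda>_. 0"])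
  next
    fix a b assume "a \<in> ?R" "b \<in> ?R"
    then obtain c e where "a = (\<Sum>j\<in>J. c j *\<^sub>R f j)" "\<forall>j\<in>J. 0 \<le> c j"
      "b = (\<Sum>j\<in>J. e j *\<^sub>R f j)" "\<forall>j\<in>J. 0 \<le> e j" by auto
    then show "a + b \<in> ?R"
      by (force intro!: exI [of _ "\<lambda>j. c j + e j"] simp: sum.distrib scaleR_add_left)
  next
    fix a and r :: real assume "a \<in> ?R" "0 \<le> r"
    then obtain c where "a = (\<Sum>j\<in>J. c j *\<^sub>R f j)" "\<forall>j\<in>J. 0 \<le> c j" by auto
    then show "r *\<^sub>R a \<in> ?R"
      using \<open>0 \<le> r\<close> by (force intro!: exI [of _ "\<lambda>j. r * c j"] simp: scaleR_sum_right)
  qed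
  ultimately show "convex_cone hull (f ` J) \<subseteq> ?R"
    by (intro hull_minimal) auto
next
  show "?R \<subseteq> convex_cone hull (f ` J)"
  proof clarify
    fix c assume c: "\<forall>j\<in>J. (0::real) \<le> c j"
    show "(\<Sum>j\<in>J. c j *\<^sub>R f j) \<in> convex_cone hull (f ` J)"
      using assms c
      by (induction J rule: finite_induct)
        (auto intro!: convex_cone_hull_contains_0 convex_cone_hull_add convex_cone_hull_mul
          intro: hull_inc hull_mono [THEN subsetD, rotated])
  qed
qed

definition slack :: "real ^ 'd ^ 'n \<Rightarrow> real ^ 'n \<Rightarrow> real ^ 'd \<Rightarrow> 'n \<Rightarrow> real" where
  "slack U x y i = row i U \<bullet> y + x $ i"

definition tight :: "real ^ 'd ^ 'n \<Rightarrow> real ^ 'n \<Rightarrow> real ^ 'd \<Rightarrow> 'n set" where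
  "tight U x y = {i. slack U x y i = 0}"

definition cone_rows :: "real ^ 'd ^ 'n \<Rightarrow> 'n set \<Rightarrow> (real ^ 'd) set" where
  "cone_rows U J = convex_cone hull ((\<lambda>i. row i U) ` J)"

text \<open>Dual form of the condition that the rows in \<open>J\<close> span the whole space: no
  nonzero direction keeps the slacks of all constraints in \<open>J\<close> constant. Vertex
  arguments use it in this form.\<close>

definition spanning :: "real ^ 'd ^ 'n \<Rightarrow> 'n set \<Rightarrow> bool" where
  "spanning U J \<longleftrightarrow> (\<forall>w. (\<forall>j\<in>J. row j U \<bullet> w = 0) \<longrightarrow> w = 0)"

text \<open>A point of the polyhedron is a vertex iff its tight rows span. Recording vertices by
  tight sets instead of coordinates makes them comparable for different \<open>x\<close>.\<close>

definition vertex_sets :: "real ^ 'd ^ 'n \<Rightarrow> real ^ 'n \<Rightarrow> 'n set set" where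
  "vertex_sets U x = {tight U x v | v. v \<in> polyhedron_of U x \<and> spanning U (tight U x v)}"

lemma slack_component: "(U *v y + x) $ i = slack U x y i"
  by (simp add: slack_def matrix_vector_mul_component row_def)

lemma mem_polyhedron_of: "y \<in> polyhedron_of U x \<longleftrightarrow> (\<forall>i. 0 \<le> slack U x y i)"
  by (simp add: polyhedron_of_def slack_component del: vector_add_component)

lemma slack_add_scaleR: "slack U x (y + t *\<^sub>R w) i = slack U x y i + t * (row i U \<bullet> w)"
  by (simp add: slack_def inner_add_right)

text \<open>Slack is affine in the pair \<open>(x, y)\<close>. Hence points of the polyhedra for
  \<open>x\<close> and \<open>x'\<close> combine to a point of the polyhedron for a convex
  combination of \<open>x\<close> and \<open>x'\<close>.\<close>

lemma slack_convex:
  "slack U ((1 - t) *\<^sub>R x + t *\<^sub>R x') ((1 - t) *\<^sub>R y + t *\<^sub>R y') i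
    = (1 - t) * slack U x y i + t * slack U x' y' i"
  by (simp add: slack_def inner_add_right algebra_simps)

lemma cone_rows_eq:
  fixes U :: "real ^ 'd ^ 'n"
  shows "cone_rows U J = {\<Sum>j\<in>J. c j *\<^sub>R row j U | c. \<forall>j\<in>J. 0 \<le> c j}"
  unfolding cone_rows_def by (rule convex_cone_hull_finite_image) simp

lemma spanning_UNIV:
  fixes U :: "real ^ 'd ^ 'n"
  assumes "rank U = CARD('d)"
  shows "spanning U UNIV"
proof -
  have "inj ((*v) U)" using assms full_rank_injective by blast
  then have "U *v w = 0 \<Longrightarrow> w = 0" for w
    by (metis inj_eq matrix_vector_mult_0_right)
  moreover have "U *v w = 0" if "\<forall>i. row i U \<bullet> w = 0" for w
    using that by (simp add: vec_eq_iff matrix_vector_mul_component row_def)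
  ultimately show ?thesis by (auto simp: spanning_def)
qed

text \<open>Constraints that are not tight leave room for a short step; a tight one reacts only
  through the sign of \<open>row j U \<bullet> w\<close>.\<close>

lemma ex_small_step:
  fixes U :: "real ^ 'd ^ 'n"
  assumes y: "y \<in> polyhedron_of U x" and w: "\<And>j. j \<in> tight U x y \<Longrightarrow> 0 \<le> row j U \<bullet> w"
  obtains e where "0 < e" "y + e *\<^sub>R w \<in> polyhedron_of U x"
    "tight U x (y + e *\<^sub>R w) = {j \<in> tight U x y. row j U \<bullet> w = 0}"
proof -
  have pos: "\<exists>e>0. \<forall>t. 0 < t \<and> t \<le> e \<longrightarrow> 0 < slack U x y i + t * (row i U \<bullet> w)" 
    if "i \<notin> tight U x y" for i
  proof -
    have s: "0 < slack U x y i"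
      using y that by (simp add: mem_polyhedron_of tight_def order_less_le)
    \<comment> \<open>The summand 1 keeps \<open>M\<close> positive when \<open>w\<close> is
      orthogonal to the row.\<close>
    define M where "M = \<bar>row i U \<bullet> w\<bar> + 1"
    have M: "0 < M" "- M < row i U \<bullet> w" by (auto simp: M_def)
    have "0 < slack U x y i + t * (row i U \<bullet> w)" if "0 < t" "t \<le> slack U x y i / M" for t
    proof -
      have "t * M \<le> slack U x y i" using that M by (simp add: field_simps)
      moreover have "t * (- M) < t * (row i U \<bullet> w)" using that M by (intro mult_strict_left_mono) auto
      ultimately show ?thesis by simp
    qed
    then show ?thesis using s M by (intro exI [of _ "slack U x y i / M"]) auto
  qed
  then obtain e where e: "\<And>i. i \<notin> tight U x y \<Longrightarrow> 0 < e i"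
    "\<And>i t. i \<notin> tight U x y \<Longrightarrow> 0 < t \<Longrightarrow> t \<le> e i \<Longrightarrow> 0 < slack U x y i + t * (row i U \<bullet> w)"
    by metis
  \<comment> \<open>The inserted 1 keeps the minimum meaningful when all constraints are
    tight.\<close>
  define m where "m = Min (insert 1 (e ` (- tight U x y)))"
  have m: "0 < m" "\<And>i. i \<notin> tight U x y \<Longrightarrow> m \<le> e i"
    using e by (auto simp: m_def)
  show thesis
  proof
    show "0 < m" by fact
    show "y + m *\<^sub>R w \<in> polyhedron_of U x"
      unfolding mem_polyhedron_of slack_add_scaleR
    proof
      fix i show "0 \<le> slack U x y i + m * (row i U \<bullet> w)"
        using e(2) [of i m] m w [of i] y by (cases "i \<in> tight U x y") (force simp: mem_polyhedron_of)+
    qed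
    show "tight U x (y + m *\<^sub>R w) = {j \<in> tight U x y. row j U \<bullet> w = 0}"
    proof (intro set_eqI)
      fix i show "i \<in> tight U x (y + m *\<^sub>R w) \<longleftrightarrow> i \<in> {j \<in> tight U x y. row j U \<bullet> w = 0}"
        using e(2) [of i m] m
        by (cases "i \<in> tight U x y") (auto simp: tight_def slack_add_scaleR)
    qed
  qed
qed

text \<open>Among the points that keep the constraints tight at \<open>y0\<close> and do not
  increase the objective, one with the most tight constraints is a vertex: otherwise a move
  orthogonal to its tight rows would reach a further constraint. With \<open>c = 0\<close> this
  yields a vertex on the smallest face containing \<open>y0\<close>.\<close>

lemma ex_vertex_above:
  fixes U :: "real ^ 'd ^ 'n"
  assumes full: "spanning U UNIV" and y0: "y0 \<in> polyhedron_of U x"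
    and bdd: "\<And>y. y \<in> polyhedron_of U x \<Longrightarrow> B \<le> c \<bullet> y"
  obtains v where "v \<in> polyhedron_of U x" "spanning U (tight U x v)"
    "tight U x y0 \<subseteq> tight U x v" "c \<bullet> v \<le> c \<bullet> y0"
proof -
  define Q where "Q y \<longleftrightarrow> y \<in> polyhedron_of U x \<and> tight U x y0 \<subseteq> tight U x y \<and> c \<bullet> y \<le> c \<bullet> y0" for y
  have "Q y0" using y0 by (simp add: Q_def)
  moreover have "\<forall>y. Q y \<longrightarrow> card (tight U x y) < CARD('n) + 1"
    by (simp add: card_mono less_Suc_eq_le)
  ultimately obtain y where Qy: "Q y" and ymax: "\<And>y'. Q y' \<Longrightarrow> card (tight U x y') \<le> card (tight U x y)"
    using ex_has_greatest_nat [of Q y0 "\<lambda>y. card (tight U x y)"] by blast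
  have "spanning U (tight U x y)"
  proof (rule ccontr)
    assume "\<not> spanning U (tight U x y)"
    then obtain w0 where w0: "\<And>j. j \<in> tight U x y \<Longrightarrow> row j U \<bullet> w0 = 0" "w0 \<noteq> 0"
      by (auto simp: spanning_def)
    obtain i0 where i0: "row i0 U \<bullet> w0 \<noteq> 0" using full w0(2) by (auto simp: spanning_def)
    \<comment> \<open>The move has to keep the tight constraints, not increase the objective, and
      eventually be blocked by some constraint. One of \<open>w0\<close> and \<open>- w0\<close>
      achieves this.\<close>
    have "\<exists>w. (\<forall>j\<in>tight U x y. row j U \<bullet> w = 0) \<and> c \<bullet> w \<le> 0 \<and> (\<exists>i. row i U \<bullet> w < 0)"
    proof (cases "c \<bullet> w0 = 0")
      case True
      show ?thesis
      proof (cases "row i0 U \<bullet> w0 < 0")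
        case True then show ?thesis using w0 \<open>c \<bullet> w0 = 0\<close> by (intro exI [of _ w0]) auto
      next
        case False then show ?thesis using w0 \<open>c \<bullet> w0 = 0\<close> i0
          by (intro exI [of _ "- w0"]) (auto intro!: exI [of _ i0])
      qed
    next
      case False
      define w where "w = (if c \<bullet> w0 < 0 then w0 else - w0)"
      have w: "\<And>j. j \<in> tight U x y \<Longrightarrow> row j U \<bullet> w = 0" "c \<bullet> w < 0"
        using w0 False by (auto simp: w_def)
      have "\<exists>i. row i U \<bullet> w < 0"
      proof (rule ccontr)
        assume "\<nexists>i. row i U \<bullet> w < 0"
        then have nn: "\<And>i. 0 \<le> row i U \<bullet> w" by (simp add: not_less)
        \<comment> \<open>A step of this length lowers the objective by
          \<open>\<bar>c \<bullet> y - B\<bar> + 1\<close>, hence below the bound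
          \<open>B\<close>.\<close>
        define t where "t = (\<bar>c \<bullet> y - B\<bar> + 1) / - (c \<bullet> w)"
        have t: "0 \<le> t" using w(2) by (simp add: t_def divide_nonneg_neg)
        have "y + t *\<^sub>R w \<in> polyhedron_of U x"
          using Qy t nn by (simp add: mem_polyhedron_of slack_add_scaleR Q_def)
        then have "B \<le> c \<bullet> y + t * (c \<bullet> w)" using bdd by (fastforce simp: inner_add_right)
        moreover have "t * (c \<bullet> w) = - (\<bar>c \<bullet> y - B\<bar> + 1)" using w(2) by (simp add: t_def)
        ultimately show False by linarith
      qed
      then show ?thesis using w by force
    qed
    then obtain w where w: "\<And>j. j \<in> tight U x y \<Longrightarrow> row j U \<bullet> w = 0" "c \<bullet> w \<le> 0"
      and neg: "\<exists>i. row i U \<bullet> w < 0" by blast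
    define N where "N = {i. row i U \<bullet> w < 0}"
    \<comment> \<open>Ratio test: \<open>g i\<close> is the step length at which constraint
      \<open>i\<close> becomes tight. The smallest of these lengths keeps the point feasible and
      makes a new constraint tight.\<close>
    define g where "g i = slack U x y i / - (row i U \<bullet> w)" for i
    have N: "finite N" "N \<noteq> {}" using neg by (auto simp: N_def)
    define t where "t = Min (g ` N)"
    have "t \<in> g ` N" unfolding t_def using N by (intro Min_in) auto
    then obtain k where k: "k \<in> N" "t = g k" by auto
    have tle: "t \<le> g i" if "i \<in> N" for i unfolding t_def using N that by auto
    have yP: "\<And>i. 0 \<le> slack U x y i" using Qy by (simp add: Q_def mem_polyhedron_of)
    have t0: "0 \<le> t" using k yP [of k] by (simp add: g_def N_def divide_nonneg_neg)
    have "y + t *\<^sub>R w \<in> polyhedron_of U x"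
      unfolding mem_polyhedron_of slack_add_scaleR
    proof
      fix i show "0 \<le> slack U x y i + t * (row i U \<bullet> w)"
      proof (cases "i \<in> N")
        case True
        then have "t * - (row i U \<bullet> w) \<le> slack U x y i"
          using tle [OF True] by (simp add: g_def N_def field_simps)
        then show ?thesis by simp
      next
        case False then show ?thesis using yP [of i] t0 by (simp add: N_def)
      qed
    qed
    moreover have sub: "tight U x y \<subseteq> tight U x (y + t *\<^sub>R w)"
      using w by (auto simp: tight_def slack_add_scaleR)
    moreover have "c \<bullet> (y + t *\<^sub>R w) \<le> c \<bullet> y"
      using t0 w(2) by (simp add: inner_add_right mult_nonneg_nonpos)
    ultimately have "Q (y + t *\<^sub>R w)" using Qy by (auto simp: Q_def)
    then have "card (tight U x (y + t *\<^sub>R w)) \<le> card (tight U x y)" by (rule ymax)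
    then have "tight U x (y + t *\<^sub>R w) = tight U x y"
      using sub by (metis card_seteq finite)
    moreover have "k \<in> tight U x (y + t *\<^sub>R w)"
      using k by (simp add: tight_def slack_add_scaleR g_def N_def field_simps)
    ultimately show False using w(1) [of k] k by (simp add: N_def)
  qed
  then show thesis using Qy that by (auto simp: Q_def)
qed

lemma vertex_eqI:
  assumes "spanning U J" "J \<subseteq> tight U x v" "J \<subseteq> tight U x w"
  shows "v = w"
proof -
  have "row j U \<bullet> (v - w) = 0" if "j \<in> J" for j
  proof -
    have "slack U x v j = 0" "slack U x w j = 0" using that assms by (auto simp: tight_def)
    then show ?thesis by (simp add: slack_def inner_diff_right)
  qed
  then have "v - w = 0" using assms(1) unfolding spanning_def by blast
  then show ?thesis by simp
qed

text \<open>A vertex is determined by its tight set, so there are finitely many. Every point has a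
  vertex with no larger objective value, so the best vertex is a global minimizer.\<close>

lemma ex_vertex_minimizer:
  fixes U :: "real ^ 'd ^ 'n"
  assumes full: "spanning U UNIV" and ne: "polyhedron_of U x \<noteq> {}"
    and bdd: "\<And>y. y \<in> polyhedron_of U x \<Longrightarrow> B \<le> c \<bullet> y"
  obtains v where "v \<in> polyhedron_of U x" "spanning U (tight U x v)"
    "\<And>y. y \<in> polyhedron_of U x \<Longrightarrow> c \<bullet> v \<le> c \<bullet> y"
proof -
  define W where "W = {v \<in> polyhedron_of U x. spanning U (tight U x v)}"
  have "inj_on (tight U x) W" by (rule inj_onI) (metis (no_types, lifting) W_def mem_Collect_eq order_refl vertex_eqI)
  then have "finite W" using finite_imageD by (metis finite)
  moreover have "W \<noteq> {}" using ne ex_vertex_above [OF full _ bdd] by (force simp: W_def)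
  ultimately obtain v where v: "v \<in> W" "\<And>v'. v' \<in> W \<Longrightarrow> c \<bullet> v \<le> c \<bullet> v'"
    using ex_is_arg_min_if_finite [of W "\<lambda>v. c \<bullet> v"] by (force simp: is_arg_min_linorder)
  show thesis
  proof
    show "v \<in> polyhedron_of U x" "spanning U (tight U x v)" using v by (auto simp: W_def)
    fix y assume "y \<in> polyhedron_of U x"
    then obtain v' where "v' \<in> W" "c \<bullet> v' \<le> c \<bullet> y"
      using ex_vertex_above [OF full _ bdd, of y] by (force simp: W_def)
    then show "c \<bullet> v \<le> c \<bullet> y" using v(2) by force
  qed
qed

text \<open>The last sum does not depend on \<open>y\<close>, so differences of the functional are
  differences of weighted slacks. This turns optimality into complementary slackness.\<close>

lemma inner_cone_rows:
  fixes U :: "real ^ 'd ^ 'n"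
  shows "(\<Sum>j\<in>J. c j *\<^sub>R row j U) \<bullet> y = (\<Sum>j\<in>J. c j * slack U x y j) - (\<Sum>j\<in>J. c j * x $ j)"
  by (simp add: inner_sum_left slack_def sum_subtractf [symmetric] algebra_simps)

text \<open>Farkas' lemma. A functional outside the closed cone is separated from it by a vector
  \<open>a\<close>, and a short step along \<open>a\<close> stays feasible while decreasing the
  functional. Conversely, the weighted slack of the tight rows vanishes at \<open>y\<close> and is
  nonnegative on the polyhedron.\<close>

lemma minimizer_iff_cone_rows:
  fixes U :: "real ^ 'd ^ 'n"
  assumes y: "y \<in> polyhedron_of U x"
  shows "(\<forall>y'\<in>polyhedron_of U x. c \<bullet> y \<le> c \<bullet> y') \<longleftrightarrow> c \<in> cone_rows U (tight U x y)"
proof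
  assume min: "\<forall>y'\<in>polyhedron_of U x. c \<bullet> y \<le> c \<bullet> y'"
  show "c \<in> cone_rows U (tight U x y)"
  proof (rule ccontr)
    let ?K = "cone_rows U (tight U x y)"
    assume "c \<notin> ?K"
    moreover have "closed ?K" "convex ?K"
      by (simp_all add: cone_rows_def convex_convex_cone_hull polyhedron_imp_closed [OF polyhedron_convex_cone_hull])
    ultimately obtain a b where ab: "a \<bullet> c < b" "\<And>k. k \<in> ?K \<Longrightarrow> b < a \<bullet> k"
      using separating_hyperplane_closed_point by metis
    have "b < 0" using ab(2) [of 0] by (simp add: cone_rows_def convex_cone_hull_contains_0)
    have "0 \<le> row j U \<bullet> a" if "j \<in> tight U x y" for j
    proof (rule ccontr)
      assume neg: "\<not> 0 \<le> row j U \<bullet> a"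
      \<comment> \<open>A positive factor, chosen so that the scaled row has inner product exactly
        \<open>b\<close> with \<open>a\<close>, against the strict separation.\<close>
      let ?t = "b / (row j U \<bullet> a)"
      have "?t *\<^sub>R row j U \<in> ?K"
        unfolding cone_rows_def using \<open>b < 0\<close> neg that
        by (intro convex_cone_hull_mul hull_inc) (auto intro: divide_nonpos_neg)
      then have "b < a \<bullet> (?t *\<^sub>R row j U)" by (rule ab)
      then show False using neg by (simp add: inner_commute)
    qed
    then obtain e where "0 < e" "y + e *\<^sub>R a \<in> polyhedron_of U x"
      using ex_small_step [OF y] by metis
    then have "c \<bullet> y \<le> c \<bullet> y + e * (c \<bullet> a)" using min by (fastforce simp: inner_add_right)
    then have "0 \<le> c \<bullet> a" using \<open>0 < e\<close> by (simp add: zero_le_mult_iff)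
    then show False using ab(1) \<open>b < 0\<close> by (simp add: inner_commute)
  qed
next
  assume "c \<in> cone_rows U (tight U x y)"
  then obtain a where a: "c = (\<Sum>j\<in>tight U x y. a j *\<^sub>R row j U)" "\<forall>j\<in>tight U x y. 0 \<le> a j"
    by (auto simp: cone_rows_eq)
  have "(\<Sum>j\<in>tight U x y. a j * slack U x y j) = 0"
    by (intro sum.neutral) (auto simp: tight_def)
  moreover have "0 \<le> (\<Sum>j\<in>tight U x y. a j * slack U x y' j)" if "y' \<in> polyhedron_of U x" for y'
    using a that by (intro sum_nonneg) (auto simp: mem_polyhedron_of)
  ultimately show "\<forall>y'\<in>polyhedron_of U x. c \<bullet> y \<le> c \<bullet> y'"
    unfolding a(1) inner_cone_rows [of _ _ _ _ x] by simp
qed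

section \<open>Faces of the polyhedron and their normal cones\<close>

lemma convex_polyhedron_of: "convex (polyhedron_of U x)"
proof (rule convexI)
  fix y y' and u v :: real
  assume "y \<in> polyhedron_of U x" "y' \<in> polyhedron_of U x" "0 \<le> u" "0 \<le> v" "u + v = 1"
  moreover from this have "u = 1 - v" by simp
  moreover have "(1 - v) *\<^sub>R x + v *\<^sub>R x = x" by (simp add: algebra_simps)
  ultimately show "u *\<^sub>R y + v *\<^sub>R y' \<in> polyhedron_of U x"
    using slack_convex [of U v x x y y'] by (simp add: mem_polyhedron_of)
qed

text \<open>A functional is minimal on all of a face iff it is minimal at one relative interior
  point, so the normal cone of the face is generated by the rows tight there. Conversely, every
  point \<open>y\<close> determines the face on which the constraints tight at \<open>y\<close> stay
  tight.\<close>

lemma normal_fan_polyhedron: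
  fixes U :: "real ^ 'd ^ 'n"
  shows "normal_fan (polyhedron_of U x) = cone_rows U ` tight U x ` polyhedron_of U x"
proof
  let ?P = "polyhedron_of U x"
  show "normal_fan ?P \<subseteq> cone_rows U ` tight U x ` ?P"
  proof
    fix \<sigma> assume "\<sigma> \<in> normal_fan ?P"
    then obtain F where F: "F face_of ?P" "F \<noteq> {}" and \<sigma>: "\<sigma> = inner_normal_cone ?P F"
      by (auto simp: normal_fan_def)
    have "convex F" "F \<subseteq> ?P" using F by (auto simp: face_of_def)
    then obtain y where y: "y \<in> rel_interior F" using F rel_interior_eq_empty by blast
    then have yF: "y \<in> F" using rel_interior_subset by blast
    then have yP: "y \<in> ?P" using \<open>F \<subseteq> ?P\<close> by blast
    have "c \<in> \<sigma> \<longleftrightarrow> (\<forall>y'\<in>?P. c \<bullet> y \<le> c \<bullet> y')" for c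
    proof
      assume "c \<in> \<sigma>" then show "\<forall>y'\<in>?P. c \<bullet> y \<le> c \<bullet> y'" using yF by (auto simp: \<sigma> inner_normal_cone_def)
    next
      assume min: "\<forall>y'\<in>?P. c \<bullet> y \<le> c \<bullet> y'"
      have "c \<bullet> f \<le> c \<bullet> y" if f: "f \<in> F" for f
      proof -
        \<comment> \<open>The segment from \<open>f\<close> to \<open>y\<close> can be prolonged
          beyond \<open>y\<close> inside \<open>F\<close>. Minimality of \<open>y\<close> at the
          prolonged point bounds the value at \<open>f\<close> from above.\<close>
        obtain e where e: "1 < e" "(1 - e) *\<^sub>R f + e *\<^sub>R y \<in> F"
          using convex_rel_interior_if [OF \<open>convex F\<close> y] f hull_inc [of f F affine] by (metis less_add_same_cancel1 order_le_less zero_less_one)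
        have "c \<bullet> y \<le> c \<bullet> ((1 - e) *\<^sub>R f + e *\<^sub>R y)" using min e \<open>F \<subseteq> ?P\<close> by blast
        then have "0 \<le> (e - 1) * (c \<bullet> y - c \<bullet> f)" by (simp add: inner_add_right algebra_simps)
        then show ?thesis using e(1) by (simp add: zero_le_mult_iff)
      qed
      then show "c \<in> \<sigma>" using min by (force simp: \<sigma> inner_normal_cone_def)
    qed
    then have "\<sigma> = cone_rows U (tight U x y)" using minimizer_iff_cone_rows [OF yP] by blast
    then show "\<sigma> \<in> cone_rows U ` tight U x ` ?P" using yP by blast
  qed
  show "cone_rows U ` tight U x ` ?P \<subseteq> normal_fan ?P"
  proof clarify
    fix y assume y: "y \<in> ?P"
    define F where "F = {y' \<in> ?P. tight U x y \<subseteq> tight U x y'}"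
    have "F face_of ?P"
      unfolding face_of_def
    proof (intro conjI ballI impI)
      show "F \<subseteq> ?P" by (auto simp: F_def)
      show "convex F"
      proof (rule convexI)
        fix a b and u v :: real
        assume ab: "a \<in> F" "b \<in> F" and uv: "0 \<le> u" "0 \<le> v" "u + v = 1"
        have "u *\<^sub>R a + v *\<^sub>R b \<in> ?P"
          using ab uv convexD [OF convex_polyhedron_of] by (auto simp: F_def)
        moreover have "slack U x (u *\<^sub>R a + v *\<^sub>R b) i = 0" if "i \<in> tight U x y" for i
        proof -
          have "slack U x a i = 0" "slack U x b i = 0" using ab that by (auto simp: F_def tight_def)
          moreover have "u = 1 - v" "(1 - v) *\<^sub>R x + v *\<^sub>R x = x" using uv by (auto simp: algebra_simps)
          ultimately show ?thesis using slack_convex [of U v x x a b i] by simp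
        qed
        ultimately show "u *\<^sub>R a + v *\<^sub>R b \<in> F" by (auto simp: F_def tight_def)
      qed
    next
      fix a b f assume ab: "a \<in> ?P" "b \<in> ?P" and f: "f \<in> F" and seg: "f \<in> open_segment a b"
      obtain t where t: "0 < t" "t < 1" "f = (1 - t) *\<^sub>R a + t *\<^sub>R b" using seg by (auto simp: in_segment)
      have "slack U x a i = 0 \<and> slack U x b i = 0" if "i \<in> tight U x y" for i
      proof -
        have "(1 - t) *\<^sub>R x + t *\<^sub>R x = x" by (simp add: algebra_simps)
        then have "0 = (1 - t) * slack U x a i + t * slack U x b i"
          using slack_convex [of U t x x a b i] f that by (auto simp: t F_def tight_def)
        moreover have "0 \<le> slack U x a i" "0 \<le> slack U x b i" using ab by (auto simp: mem_polyhedron_of)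
        ultimately show ?thesis using t(1,2)
          by (smt (verit) mult_pos_pos mult_nonneg_nonneg)
      qed
      then show "a \<in> F" "b \<in> F" using ab by (auto simp: F_def tight_def)
    qed
    moreover have "y \<in> F" using y by (simp add: F_def)
    moreover have "inner_normal_cone ?P F = cone_rows U (tight U x y)"
    proof (intro set_eqI iffI)
      fix c assume "c \<in> inner_normal_cone ?P F"
      then show "c \<in> cone_rows U (tight U x y)"
        using \<open>y \<in> F\<close> minimizer_iff_cone_rows [OF y] by (auto simp: inner_normal_cone_def)
    next
      fix c assume c: "c \<in> cone_rows U (tight U x y)"
      have "c \<in> cone_rows U (tight U x f)" if "f \<in> F" for f
        using c that unfolding cone_rows_def F_def
        by (metis (no_types, lifting) hull_mono image_mono mem_Collect_eq subsetD)
      then show "c \<in> inner_normal_cone ?P F"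
        using minimizer_iff_cone_rows [of _ U x c] by (auto simp: inner_normal_cone_def F_def)
    qed
    ultimately show "cone_rows U (tight U x y) \<in> normal_fan ?P"
      unfolding normal_fan_def by blast
  qed
qed

section \<open>Chambers and the combinatorial type\<close>

text \<open>In a representation of \<open>x\<close> as a cone element plus \<open>U *v b\<close>,
  the cone coefficients are the slacks at the point \<open>- b\<close>; those outside
  \<open>I\<close> are zero.\<close>

lemma mem_cone_of_iff:
  fixes U :: "real ^ 'd ^ 'n"
  shows "x \<in> cone_of U I \<longleftrightarrow> (\<exists>y\<in>polyhedron_of U x. - I \<subseteq> tight U x y)"
proof -
  have comp: "(\<Sum>j\<in>I. c j *\<^sub>R axis j (1::real)) $ i = (if i \<in> I then c i else 0)" for c and i :: 'n
    by (simp add: axis_def if_distrib [of "\<lambda>r. _ * r"] cong: if_cong)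
  show ?thesis
  proof
    assume "x \<in> cone_of U I"
    then obtain c b where c: "\<forall>j\<in>I. 0 \<le> c j" and x: "x = (\<Sum>j\<in>I. c j *\<^sub>R axis j 1) + U *v b"
      by (auto simp: cone_of_def convex_cone_hull_finite_image)
    have "slack U x (- b) i = (if i \<in> I then c i else 0)" for i
      unfolding slack_component [symmetric] comp [of c i, symmetric] by (simp add: x vec.neg)
    then show "\<exists>y\<in>polyhedron_of U x. - I \<subseteq> tight U x y"
      using c by (intro bexI [of _ "- b"]) (auto simp: tight_def mem_polyhedron_of)
  next
    assume "\<exists>y\<in>polyhedron_of U x. - I \<subseteq> tight U x y"
    then obtain y where y: "y \<in> polyhedron_of U x" "- I \<subseteq> tight U x y" by blast
    have "U *v y + x = (\<Sum>j\<in>I. slack U x y j *\<^sub>R axis j 1)"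
      unfolding vec_eq_iff comp slack_component using y(2) by (auto simp: tight_def)
    moreover have "x = (U *v y + x) + U *v (- y)" by (simp add: vec.neg)
    ultimately have "x = (\<Sum>j\<in>I. slack U x y j *\<^sub>R axis j 1) + U *v (- y)" by simp
    moreover have "\<forall>j\<in>I. 0 \<le> slack U x y j" using y(1) by (simp add: mem_polyhedron_of)
    ultimately show "x \<in> cone_of U I"
      unfolding cone_of_def convex_cone_hull_finite_image [OF finite] by blast
  qed
qed

text \<open>For \<open>I\<close> the complement of the tight set of \<open>v\<close>, the cone
  \<open>cone_of U I\<close> contains \<open>x0\<close> and therefore the whole chamber of
  \<open>x0\<close>.\<close>

lemma chamber_tight:
  fixes U :: "real ^ 'd ^ 'n"
  assumes "x \<in> chamber U x0" "v \<in> polyhedron_of U x0"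
  obtains y where "y \<in> polyhedron_of U x" "tight U x0 v \<subseteq> tight U x y"
proof -
  have "x0 \<in> cone_of U (- tight U x0 v)" using assms(2) by (auto simp: mem_cone_of_iff)
  then have "x \<in> cone_of U (- tight U x0 v)"
    using assms(1) by (auto simp: chamber_def split: if_splits)
  then show thesis using that by (auto simp: mem_cone_of_iff)
qed

lemma polyhedron_nonempty_if_chamber:
  "chamber U x \<noteq> {} \<Longrightarrow> polyhedron_of U x \<noteq> {}"
  by (auto simp: chamber_def mem_cone_of_iff split: if_splits)

text \<open>Independence as an indexed family: without injectivity, the image set would forget
  repeated rows.\<close>

definition indep_rows :: "real ^ 'd ^ 'n \<Rightarrow> 'n set \<Rightarrow> bool" where
  "indep_rows U J \<longleftrightarrow> inj_on (\<lambda>j. row j U) J \<and> independent ((\<lambda>j. row j U) ` J)"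

lemma indep_rowsI:
  fixes U :: "real ^ 'd ^ 'n"
  assumes "\<And>a. (\<Sum>j\<in>J. a j *\<^sub>R row j U) = 0 \<Longrightarrow> \<forall>j\<in>J. a j = 0"
  shows "indep_rows U J"
  unfolding indep_rows_def
proof
  show inj: "inj_on (\<lambda>j. row j U) J"
  proof (rule inj_onI, rule ccontr)
    fix j k assume jk: "j \<in> J" "k \<in> J" "row j U = row k U" "j \<noteq> k"
    have delta: "(\<Sum>i\<in>J. (if i = l then 1 else 0) *\<^sub>R row i U) = row l U" if "l \<in> J" for l
      using that by (simp add: if_distrib [of "\<lambda>r. r *\<^sub>R _"] cong: if_cong)
    have "(\<Sum>i\<in>J. ((if i = j then 1 else 0) - (if i = k then 1 else 0)) *\<^sub>R row i U) = 0"
      unfolding scaleR_diff_left sum_subtractf delta [OF jk(1)] delta [OF jk(2)] using jk(3) by simp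
    from assms [OF this] show False using jk by force
  qed
  show "independent ((\<lambda>j. row j U) ` J)"
  proof (rule independent_if_scalars_zero)
    fix f b assume "(\<Sum>b\<in>(\<lambda>j. row j U) ` J. f b *\<^sub>R b) = 0" and b: "b \<in> (\<lambda>j. row j U) ` J"
    then have "(\<Sum>j\<in>J. f (row j U) *\<^sub>R row j U) = 0" by (simp add: sum.reindex [OF inj])
    then show "f b = 0" using assms [of "\<lambda>j. f (row j U)"] b by blast
  qed simp
qed

lemma indep_rows_subset: "indep_rows U J \<Longrightarrow> J' \<subseteq> J \<Longrightarrow> indep_rows U J'"
  unfolding indep_rows_def by (meson image_mono independent_mono inj_on_subset)

lemma indep_rows_ex_inner:
  fixes U :: "real ^ 'd ^ 'n"
  assumes "indep_rows U J"
  obtains w where "\<And>j. j \<in> J \<Longrightarrow> row j U \<bullet> w = b j"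
proof -
  have inj: "inj_on (\<lambda>j. row j U) J" using assms by (simp add: indep_rows_def)
  have ind: "independent ((\<lambda>j. row j U) ` J)" using assms by (simp add: indep_rows_def)
  obtain g :: "real ^ 'd \<Rightarrow> real" where g: "linear g"
    "\<forall>r\<in>(\<lambda>j. row j U) ` J. g r = b (inv_into J (\<lambda>j. row j U) r)"
    using linear_independent_extend [OF ind, of "\<lambda>r. b (inv_into J (\<lambda>j. row j U) r)"] by blast
  show thesis
  proof
    fix j assume j: "j \<in> J"
    \<comment> \<open>\<open>adjoint g 1\<close> is the vector representing the functional
      \<open>g\<close> under the inner product.\<close>
    have "row j U \<bullet> adjoint g 1 = g (row j U)" by (simp add: adjoint_works g(1))
    then show "row j U \<bullet> adjoint g 1 = b j" using g(2) j inv_into_f_f [OF inj j] by simp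
  qed
qed

lemma span_rows_eq_UNIV:
  fixes U :: "real ^ 'd ^ 'n"
  assumes "spanning U J"
  shows "span ((\<lambda>j. row j U) ` J) = UNIV"
proof (rule ccontr)
  assume "span ((\<lambda>j. row j U) ` J) \<noteq> UNIV"
  then obtain a where "a \<noteq> 0" "\<forall>r\<in>span ((\<lambda>j. row j U) ` J). a \<bullet> r = 0"
    using span_not_UNIV_orthogonal by metis
  then show False using assms span_base unfolding spanning_def
    by (metis image_eqI inner_commute)
qed

lemma card_indep_rows:
  "indep_rows U J \<Longrightarrow> card J = dim ((\<lambda>j. row j U) ` J)"
  by (simp add: indep_rows_def dim_eq_card_independent card_image)

lemma card_basis_rows:
  fixes U :: "real ^ 'd ^ 'n"
  assumes "indep_rows U J" "spanning U J"
  shows "card J = CARD('d)"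
  using card_indep_rows [OF assms(1)] span_rows_eq_UNIV [OF assms(2)]
  by (metis dim_UNIV dim_span DIM_cart DIM_real mult.right_neutral)

lemma dim_cone_rows:
  "dim (cone_rows U J) = dim ((\<lambda>j. row j U) ` J)"
proof (rule antisym)
  have "cone_rows U J \<subseteq> span ((\<lambda>j. row j U) ` J)"
    unfolding cone_rows_def by (intro hull_minimal convex_cone_span span_superset)
  then show "dim (cone_rows U J) \<le> dim ((\<lambda>j. row j U) ` J)" by (metis dim_span dim_subset)
  show "dim ((\<lambda>j. row j U) ` J) \<le> dim (cone_rows U J)"
    unfolding cone_rows_def by (intro dim_subset hull_subset)
qed

section \<open>Perturbation inside a full-dimensional chamber\<close>

lemma interior_step:
  fixes x :: "'a :: euclidean_space"
  assumes "x \<in> interior C"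
  obtains t :: real where "0 < t" "x + t *\<^sub>R a \<in> C"
proof -
  obtain e where e: "0 < e" "ball x e \<subseteq> C" using assms by (auto simp: mem_interior)
  \<comment> \<open>The denominator exceeds \<open>norm a\<close> and is positive even for
    \<open>a = 0\<close>, so the step stays inside the ball.\<close>
  define t where "t = e / ((norm a + 1) * 2)"
  have "0 < t" using e(1) by (simp add: t_def add_nonneg_pos)
  have "norm a < (norm a + 1) * 2" using norm_ge_zero [of a] by argo
  then have "t * norm a < t * ((norm a + 1) * 2)" using \<open>0 < t\<close> by (rule mult_strict_left_mono)
  also have "\<dots> = e" using norm_ge_zero [of a] unfolding t_def by (metis add_nonneg_pos less_irrefl mult_pos_pos nonzero_eq_divide_eq zero_less_numeral zero_less_one)
  finally have "x + t *\<^sub>R a \<in> ball x e" using \<open>0 < t\<close> by (simp add: dist_norm)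
  then show thesis using that \<open>0 < t\<close> e(2) by blast
qed

text \<open>Each point of the chamber of \<open>x0\<close> has a feasible point tight on the set
  \<open>J\<close> tight at \<open>v\<close>, so a linear relation among the rows in
  \<open>J\<close> would confine the chamber to a hyperplane. A set with interior points does not
  fit into one.\<close>

lemma indep_rows_vertex_sets_chamber:
  fixes U :: "real ^ 'd ^ 'n"
  assumes x: "x \<in> interior (chamber U x0)" and v: "v \<in> polyhedron_of U x0"
  shows "indep_rows U (tight U x0 v)"
proof (rule indep_rowsI)
  let ?J = "tight U x0 v"
  fix a assume a: "(\<Sum>j\<in>?J. a j *\<^sub>R row j U) = 0"
  \<comment> \<open>The perturbation direction is the relation itself, so the relation changes by
    \<open>t\<close> times the sum of the squared coefficients.\<close>
  define b :: "real ^ 'n" where "b = (\<chi> j. if j \<in> ?J then a j else 0)"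
  obtain t where t: "0 < t" "x + t *\<^sub>R b \<in> chamber U x0" using interior_step [OF x] .
  have "(\<Sum>j\<in>?J. a j * x' $ j) = 0" if x': "x' \<in> chamber U x0" for x'
  proof -
    obtain y where "?J \<subseteq> tight U x' y" using chamber_tight [OF x' v] by blast
    then have "(\<Sum>j\<in>?J. a j * slack U x' y j) = 0" by (intro sum.neutral) (auto simp: tight_def)
    then show ?thesis using inner_cone_rows [of a U ?J y x'] a by simp
  qed
  from this [OF t(2)] this [of x] have "(\<Sum>j\<in>?J. a j * (x + t *\<^sub>R b) $ j) - (\<Sum>j\<in>?J. a j * x $ j) = 0"
    using x interior_subset by force
  then have "t * (\<Sum>j\<in>?J. (a j)\<^sup>2) = 0"
    by (simp add: sum_subtractf [symmetric] sum_distrib_left b_def power2_eq_square algebra_simps)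
  then show "\<forall>j\<in>?J. a j = 0" using t(1) by (simp add: sum_nonneg_eq_0_iff)
qed

text \<open>Vertices at \<open>x0\<close> persist because \<open>x\<close> lies strictly between
  \<open>x0\<close> and another chamber point, or equals \<open>x0\<close>. No vertex arises newly
  at \<open>x\<close>: the functional exposing it attains its minimum at \<open>x0\<close> in a
  vertex whose tight set persists, and at \<open>x\<close> the functional has only one
  minimizer.\<close>

lemma vertex_sets_chamber:
  fixes U :: "real ^ 'd ^ 'n"
  assumes full: "spanning U UNIV" and x: "x \<in> interior (chamber U x0)"
  shows "vertex_sets U x = vertex_sets U x0"
proof
  show sub: "vertex_sets U x0 \<subseteq> vertex_sets U x"
  proof
    fix J assume "J \<in> vertex_sets U x0"
    then obtain v where v: "v \<in> polyhedron_of U x0" "spanning U (tight U x0 v)" and J: "J = tight U x0 v"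
      by (auto simp: vertex_sets_def)
    \<comment> \<open>The chamber point beyond \<open>x\<close>, seen from \<open>x0\<close>, makes
      \<open>x\<close> a convex combination with positive weight on \<open>x0\<close>. This weight
      keeps constraints outside \<open>J\<close> from becoming tight.\<close>
    obtain e where e: "0 < e" "x + e *\<^sub>R (x - x0) \<in> chamber U x0" using interior_step [OF x] .
    define x' where "x' = x + e *\<^sub>R (x - x0)"
    obtain y' where y': "y' \<in> polyhedron_of U x'" "J \<subseteq> tight U x' y'"
      using chamber_tight [OF e(2) v(1)] unfolding x'_def J by blast
    define t where "t = 1 / (1 + e)"
    have t: "0 < t" "t < 1" using e by (auto simp: t_def)
    have "(1 + e) *\<^sub>R x = e *\<^sub>R x0 + x'" by (simp add: x'_def algebra_simps)
    then have "t *\<^sub>R ((1 + e) *\<^sub>R x) = t *\<^sub>R (e *\<^sub>R x0 + x')" by simp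
    moreover have "t * e = 1 - t" "t * (1 + e) = 1" using e by (auto simp: t_def field_simps)
    ultimately have xt: "x = (1 - t) *\<^sub>R x0 + t *\<^sub>R x'" by (simp add: scaleR_add_right)
    define y where "y = (1 - t) *\<^sub>R v + t *\<^sub>R y'"
    have s: "slack U x y i = (1 - t) * slack U x0 v i + t * slack U x' y' i" for i
      unfolding xt y_def by (rule slack_convex)
    have nn: "0 \<le> slack U x0 v i" "0 \<le> slack U x' y' i" for i
      using v y' by (auto simp: mem_polyhedron_of)
    have "y \<in> polyhedron_of U x" using nn t by (simp add: mem_polyhedron_of s)
    moreover have "tight U x y = J"
    proof (intro set_eqI iffI)
      fix i assume "i \<in> tight U x y"
      then have "(1 - t) * slack U x0 v i + t * slack U x' y' i = 0" by (simp add: tight_def s)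
      moreover have "0 \<le> (1 - t) * slack U x0 v i" "0 \<le> t * slack U x' y' i" using nn t by auto
      ultimately have "(1 - t) * slack U x0 v i = 0" by linarith
      then show "i \<in> J" using t by (simp add: J tight_def)
    next
      fix i assume "i \<in> J"
      moreover from this have "slack U x' y' i = 0" using y' by (auto simp: tight_def)
      ultimately show "i \<in> tight U x y" by (simp add: tight_def s J)
    qed
    ultimately show "J \<in> vertex_sets U x" using v J by (force simp: vertex_sets_def)
  qed
  show "vertex_sets U x \<subseteq> vertex_sets U x0"
  proof
    fix J assume "J \<in> vertex_sets U x"
    then obtain w where w: "w \<in> polyhedron_of U x" "spanning U (tight U x w)" and J: "J = tight U x w"
      by (auto simp: vertex_sets_def)
    \<comment> \<open>Up to a constant, \<open>c\<close> is the total slack over \<open>J\<close>.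
      It is minimal over \<open>polyhedron_of U x\<close> exactly where all of \<open>J\<close> is
      tight, and this happens only at \<open>w\<close>.\<close>
    define c where "c = (\<Sum>j\<in>J. 1 *\<^sub>R row j U)"
    have ne: "polyhedron_of U x0 \<noteq> {}"
      using x interior_subset by (intro polyhedron_nonempty_if_chamber) blast
    have "- (\<Sum>j\<in>J. 1 * x0 $ j) \<le> c \<bullet> y" if "y \<in> polyhedron_of U x0" for y
    proof -
      have "0 \<le> (\<Sum>j\<in>J. 1 * slack U x0 y j)" using that by (intro sum_nonneg) (auto simp: mem_polyhedron_of)
      then show ?thesis using inner_cone_rows [of "\<lambda>_. 1" U J y x0] by (simp add: c_def)
    qed
    then obtain v where v: "v \<in> polyhedron_of U x0" "spanning U (tight U x0 v)"
      "\<forall>y\<in>polyhedron_of U x0. c \<bullet> v \<le> c \<bullet> y"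
      using ex_vertex_minimizer [OF full ne, of _ c] by metis
    have c: "c \<in> cone_rows U (tight U x0 v)" using minimizer_iff_cone_rows [OF v(1)] v(3) by blast
    have "tight U x0 v \<in> vertex_sets U x" using v sub by (auto simp: vertex_sets_def)
    then obtain v' where v': "v' \<in> polyhedron_of U x" "tight U x v' = tight U x0 v"
      by (auto simp: vertex_sets_def)
    then have "c \<bullet> v' \<le> c \<bullet> w" using minimizer_iff_cone_rows [OF v'(1), of c] c w(1) by simp
    moreover have "(\<Sum>j\<in>J. 1 * slack U x w j) = 0" by (simp add: J tight_def)
    ultimately have "(\<Sum>j\<in>J. slack U x v' j) \<le> 0"
      using inner_cone_rows [of "\<lambda>_. 1" U J _ x] by (simp add: c_def)
    moreover have nn: "\<And>j. 0 \<le> slack U x v' j" using v' by (simp add: mem_polyhedron_of)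
    ultimately have "(\<Sum>j\<in>J. slack U x v' j) = 0" by (meson antisym sum_nonneg)
    then have "\<forall>j\<in>J. slack U x v' j = 0" using nn by (simp add: sum_nonneg_eq_0_iff)
    then have "J \<subseteq> tight U x v'" by (auto simp: tight_def)
    then have "w = v'" using w(2) vertex_eqI [of U J x] J by blast
    then show "J \<in> vertex_sets U x0" using v v' J by (auto simp: vertex_sets_def)
  qed
qed

text \<open>Independence of the rows tight at a vertex allows a direction that keeps any prescribed
  subset tight and releases the rest. Conversely, each tight set extends to that of a
  vertex.\<close>

lemma tight_image_polyhedron:
  fixes U :: "real ^ 'd ^ 'n"
  assumes full: "spanning U UNIV" and ind: "\<And>J. J \<in> vertex_sets U x \<Longrightarrow> indep_rows U J"
  shows "tight U x ` polyhedron_of U x = {J'. \<exists>J\<in>vertex_sets U x. J' \<subseteq> J}"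
proof (intro set_eqI iffI)
  fix J' assume "J' \<in> tight U x ` polyhedron_of U x"
  then obtain y where y: "y \<in> polyhedron_of U x" "J' = tight U x y" by auto
  obtain v where "v \<in> polyhedron_of U x" "spanning U (tight U x v)" "J' \<subseteq> tight U x v"
    using ex_vertex_above [OF full y(1), of 0 0] y(2) by auto
  then show "J' \<in> {J'. \<exists>J\<in>vertex_sets U x. J' \<subseteq> J}" by (auto simp: vertex_sets_def)
next
  fix J' assume "J' \<in> {J'. \<exists>J\<in>vertex_sets U x. J' \<subseteq> J}"
  then obtain J where J: "J \<in> vertex_sets U x" "J' \<subseteq> J" by auto
  then obtain v where v: "v \<in> polyhedron_of U x" "J = tight U x v" by (auto simp: vertex_sets_def)
  obtain w where w: "\<And>j. j \<in> J \<Longrightarrow> row j U \<bullet> w = (if j \<in> J' then 0 else 1)"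
    using indep_rows_ex_inner [OF ind [OF J(1)], of "\<lambda>j. if j \<in> J' then 0 else 1"] by blast
  then have "\<And>j. j \<in> J \<Longrightarrow> 0 \<le> row j U \<bullet> w" by simp
  then obtain e where e: "v + e *\<^sub>R w \<in> polyhedron_of U x"
    "tight U x (v + e *\<^sub>R w) = {j \<in> J. row j U \<bullet> w = 0}"
    using ex_small_step [OF v(1), of w] unfolding v(2) [symmetric] by blast
  have "{j \<in> J. row j U \<bullet> w = 0} = J'" using w J(2) by (auto split: if_splits)
  then show "J' \<in> tight U x ` polyhedron_of U x" using e by (metis image_eqI)
qed

section \<open>Cones of the normal fan\<close>

lemma row_ray_eq: "row_ray U i = cone_rows U {i}"
  by (simp add: row_ray_def cone_rows_def)

lemma cone_rows_singleton:
  fixes U :: "real ^ 'd ^ 'n"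
  shows "cone_rows U {i} = {c *\<^sub>R row i U | c. 0 \<le> c}"
  by (force simp: cone_rows_eq)

text \<open>A vector dual to the basis, zero on row \<open>i\<close> and one on the other rows of
  \<open>J\<close>, defines a supporting hyperplane that meets the cone in this ray.\<close>

lemma row_ray_face_of:
  fixes U :: "real ^ 'd ^ 'n"
  assumes J: "indep_rows U J" and i: "i \<in> J"
  shows "row_ray U i face_of cone_rows U J"
proof -
  obtain w where w: "\<And>j. j \<in> J \<Longrightarrow> row j U \<bullet> w = (if j = i then 0 else 1)"
    using indep_rows_ex_inner [OF J, of "\<lambda>j. if j = i then 0 else 1"] by blast
  have val: "w \<bullet> (\<Sum>j\<in>J. c j *\<^sub>R row j U) = sum c (J - {i})" for c
  proof -
    have "w \<bullet> (\<Sum>j\<in>J. c j *\<^sub>R row j U) = (\<Sum>j\<in>J. c j * (if j = i then 0 else 1))"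
      using w by (simp add: inner_sum_right inner_commute [of w])
    also have "\<dots> = (\<Sum>j\<in>J - {i}. c j * (if j = i then 0 else 1))"
      using i by (simp add: sum.remove)
    finally show ?thesis by simp
  qed
  have "cone_rows U J \<inter> {u. w \<bullet> u = 0} face_of cone_rows U J"
  proof (rule face_of_Int_supporting_hyperplane_ge)
    show "convex (cone_rows U J)" by (simp add: cone_rows_def convex_convex_cone_hull)
    fix u assume "u \<in> cone_rows U J"
    then obtain c where "u = (\<Sum>j\<in>J. c j *\<^sub>R row j U)" "\<forall>j\<in>J. 0 \<le> c j"
      by (auto simp: cone_rows_eq)
    then show "0 \<le> w \<bullet> u" by (auto simp: val intro!: sum_nonneg)
  qed
  moreover have "cone_rows U J \<inter> {u. w \<bullet> u = 0} = row_ray U i"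
  proof (intro equalityI subsetI)
    fix u assume u: "u \<in> cone_rows U J \<inter> {u. w \<bullet> u = 0}"
    then obtain c where c: "u = (\<Sum>j\<in>J. c j *\<^sub>R row j U)" "\<forall>j\<in>J. 0 \<le> c j"
      by (auto simp: cone_rows_eq)
    have "sum c (J - {i}) = 0" using u by (simp add: c(1) val)
    then have "\<forall>j\<in>J - {i}. c j = 0"
      using c(2) by (subst (asm) sum_nonneg_eq_0_iff) auto
    then have "(\<Sum>j\<in>J - {i}. c j *\<^sub>R row j U) = 0" by (simp add: sum.neutral)
    then have "u = c i *\<^sub>R row i U" unfolding c(1) using i by (simp add: sum.remove)
    then show "u \<in> row_ray U i" using c i by (auto simp: row_ray_eq cone_rows_singleton)
  next
    fix u assume "u \<in> row_ray U i"
    then obtain c where c: "u = c *\<^sub>R row i U" "0 \<le> c" by (auto simp: row_ray_eq cone_rows_singleton)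
    then have "u \<in> cone_rows U J"
      unfolding cone_rows_def c(1) using i c(2) by (intro convex_cone_hull_mul hull_inc) auto
    moreover have "w \<bullet> u = 0" using w [OF i] by (simp add: c inner_commute)
    ultimately show "u \<in> cone_rows U J \<inter> {u. w \<bullet> u = 0}" by simp
  qed
  ultimately show ?thesis by simp
qed

text \<open>If the ray of row \<open>i\<close> is a face, then a nonzero summand in a conic
  representation of row \<open>i\<close> by rows of \<open>J\<close> must lie on that ray. Row
  \<open>j\<close> of this summand is then a positive multiple of row \<open>i\<close>, and distinct
  rows generate distinct rays.\<close>

lemma ray_indices_cone_rows:
  fixes U :: "real ^ 'd ^ 'n"
  assumes J: "indep_rows U J" and inj: "inj (row_ray U)"
  shows "ray_indices U (cone_rows U J) = J"
proof (intro equalityI subsetI)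
  fix i assume i: "i \<in> J"
  have "indep_rows U {i}" using indep_rows_subset [OF J] i by simp
  then have "dim (row_ray U i) = 1"
    using card_indep_rows [of U "{i}"] by (simp only: row_ray_eq dim_cone_rows) simp
  then show "i \<in> ray_indices U (cone_rows U J)"
    using row_ray_face_of [OF J i] by (simp add: ray_indices_def rays_of_cone_def)
next
  fix i assume "i \<in> ray_indices U (cone_rows U J)"
  then have face: "row_ray U i face_of cone_rows U J" and dim: "dim (row_ray U i) = 1"
    by (auto simp: ray_indices_def rays_of_cone_def)
  have nz: "row i U \<noteq> 0"
  proof
    assume "row i U = 0"
    then have "row_ray U i \<subseteq> {0}" by (auto simp: row_ray_eq cone_rows_singleton)
    then have "dim (row_ray U i) = 0" by simp
    then show False using dim by simp
  qed
  have iray: "row i U \<in> row_ray U i" by (simp add: row_ray_def hull_inc)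
  then have "row i U \<in> cone_rows U J" using face face_of_imp_subset by blast
  then obtain c where c: "row i U = (\<Sum>j\<in>J. c j *\<^sub>R row j U)" "\<forall>j\<in>J. 0 \<le> c j"
    by (auto simp: cone_rows_eq)
  have "\<exists>j\<in>J. c j *\<^sub>R row j U \<noteq> 0"
  proof (rule ccontr)
    assume "\<not> ?thesis"
    then have "(\<Sum>j\<in>J. c j *\<^sub>R row j U) = 0" by (intro sum.neutral) blast
    then show False using nz c(1) by simp
  qed
  then obtain j where j: "j \<in> J" "c j *\<^sub>R row j U \<noteq> 0" by blast
  \<comment> \<open>Doubling the summand and the remainder makes row \<open>i\<close> their
    midpoint, so the face property applies.\<close>
  let ?a = "(2 * c j) *\<^sub>R row j U" and ?b = "2 *\<^sub>R (\<Sum>k\<in>J - {j}. c k *\<^sub>R row k U)"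
  have a: "?a \<in> cone_rows U J"
    unfolding cone_rows_def using j c(2) by (intro convex_cone_hull_mul hull_inc) auto
  have "(\<Sum>k\<in>J - {j}. c k *\<^sub>R row k U) \<in> cone_rows U (J - {j})"
    using c(2) by (auto simp: cone_rows_eq)
  then have b: "?b \<in> cone_rows U J"
    unfolding cone_rows_def using hull_mono [of "(\<lambda>i. row i U) ` (J - {j})" "(\<lambda>i. row i U) ` J" convex_cone]
    by (intro convex_cone_hull_mul) auto
  have mid: "row i U = (1 - 1/2) *\<^sub>R ?a + (1/2) *\<^sub>R ?b"
    using j(1) by (simp add: c(1) sum.remove [of J j])
  have "?a \<in> row_ray U i"
  \<comment> \<open>For equal end points the open segment is empty, but then row \<open>i\<close> is
    \<open>?a\<close> itself.\<close>
  proof (cases "?a = ?b")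
    case True
    have "row i U = ((1 - 1/2) + (1/2)) *\<^sub>R ?a"
      using mid unfolding True [symmetric] scaleR_add_left .
    then have "row i U = ?a" by simp
    then show ?thesis using iray by simp
  next
    case False
    have "row i U \<in> open_segment ?a ?b"
      unfolding in_segment using False mid by (intro conjI exI [of _ "1/2"]) auto
    then show ?thesis using face a b iray unfolding face_of_def by blast
  qed
  then obtain t where t: "(2 * c j) *\<^sub>R row j U = t *\<^sub>R row i U" "0 \<le> t"
    by (auto simp: row_ray_eq cone_rows_singleton)
  have cj: "0 < c j" using j c(2) by (metis order_le_less scaleR_zero_left)
  have "t \<noteq> 0" using t(1) j(2) by auto
  then have t0: "0 < t" using t(2) by simp
  define r where "r = t / (2 * c j)"
  have r: "0 < r" using t0 cj by (simp add: r_def)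
  have "row j U = r *\<^sub>R row i U"
  proof -
    have "row j U = (1 / (2 * c j)) *\<^sub>R ((2 * c j) *\<^sub>R row j U)" using cj by simp
    then show ?thesis unfolding t(1) by (simp add: r_def)
  qed
  then have "row_ray U j = row_ray U i"
  proof (intro equalityI subsetI)
    fix u assume "u \<in> row_ray U j" and rj: "row j U = r *\<^sub>R row i U"
    then obtain k where "u = k *\<^sub>R row j U" "0 \<le> k" by (auto simp: row_ray_eq cone_rows_singleton)
    then have "u = (k * r) *\<^sub>R row i U" "0 \<le> k * r" using r by (simp_all add: rj)
    then show "u \<in> row_ray U i" by (auto simp: row_ray_eq cone_rows_singleton)
  next
    fix u assume "u \<in> row_ray U i" and rj: "row j U = r *\<^sub>R row i U"
    then obtain k where "u = k *\<^sub>R row i U" "0 \<le> k" by (auto simp: row_ray_eq cone_rows_singleton)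
    then have "u = (k / r) *\<^sub>R row j U" "0 \<le> k / r" using r by (simp_all add: rj)
    then show "u \<in> row_ray U j" by (auto simp: row_ray_eq cone_rows_singleton)
  qed
  then show "i \<in> J" using inj j(1) by (metis injD)
qed

text \<open>Constant vertex sets give a constant normal fan on the interior, which equals the
  relative interior since it is nonempty. The definite description therefore selects the common
  fan.\<close>

lemma fan_of_chamber_eq:
  fixes U :: "real ^ 'd ^ 'n"
  assumes full: "spanning U UNIV" and z: "z \<in> interior (chamber U x0)"
  shows "fan_of_chamber U (chamber U x0) = cone_rows U ` {J'. \<exists>J\<in>vertex_sets U z. J' \<subseteq> J}"
proof -
  have nf: "normal_fan (polyhedron_of U x) = cone_rows U ` {J'. \<exists>J\<in>vertex_sets U z. J' \<subseteq> J}"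
    if x: "x \<in> interior (chamber U x0)" for x
  proof -
    have V: "vertex_sets U x = vertex_sets U x0" "vertex_sets U z = vertex_sets U x0"
      by (rule vertex_sets_chamber [OF full]; fact)+
    have "indep_rows U J" if "J \<in> vertex_sets U x" for J
      using that indep_rows_vertex_sets_chamber [OF x] unfolding V(1) unfolding vertex_sets_def by blast
    then show ?thesis
      using tight_image_polyhedron [OF full, of x] by (simp add: normal_fan_polyhedron V)
  qed
  have "rel_interior (chamber U x0) = interior (chamber U x0)"
    using z by (intro rel_interior_nonempty_interior) blast
  then show ?thesis
    unfolding fan_of_chamber_def using nf z by (intro the_equality) auto
qed

text \<open>The cone over an independent set of rows has the cardinality of the set as dimension, so
  proper subsets of a basis give smaller dimension.\<close>

lemma cones_of_full_dim:
  fixes U :: "real ^ 'd ^ 'n"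
  assumes V: "\<And>J. J \<in> V \<Longrightarrow> indep_rows U J \<and> spanning U J"
  shows "cones_of_dim CARD('d) (cone_rows U ` {J'. \<exists>J\<in>V. J' \<subseteq> J}) = cone_rows U ` V"
proof -
  have "J' = J" if "J \<in> V" "J' \<subseteq> J" "dim (cone_rows U J') = CARD('d)" for J J'
  proof -
    have "indep_rows U J'" using V that indep_rows_subset by blast
    then have "card J' = CARD('d)" using that(3) by (simp add: card_indep_rows dim_cone_rows)
    moreover have "card J = CARD('d)" using V [OF that(1)] card_basis_rows by blast
    ultimately show ?thesis using that(2) by (metis card_subset_eq finite)
  qed
  moreover have "dim (cone_rows U J) = CARD('d)" if "J \<in> V" for J
    using V [OF that] card_basis_rows card_indep_rows dim_cone_rows by metis
  ultimately show ?thesis unfolding cones_of_dim_def by blast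
qed

lemma universal_adjoint_cone_rows:
  fixes U :: "real ^ 'd ^ 'n"
  assumes inj: "inj (row_ray U)" and V: "\<And>J. J \<in> V \<Longrightarrow> indep_rows U J \<and> spanning U J"
  shows "universal_adjoint U (cone_rows U ` {J'. \<exists>J\<in>V. J' \<subseteq> J}) x
    = (\<Sum>J\<in>V. abs_det_rows U J * (\<Prod>i\<in>- J. x $ i))"
proof -
  have ri: "ray_indices U (cone_rows U J) = J" if "J \<in> V" for J
    using V that inj ray_indices_cone_rows by blast
  have cones: "cones_of_dim CARD('d) (cone_rows U ` {J'. \<exists>J\<in>V. J' \<subseteq> J}) = cone_rows U ` V"
    by (rule cones_of_full_dim) (rule V)
  have "inj_on (cone_rows U) V" using ri by (metis inj_onI)
  then show ?thesis
    unfolding universal_adjoint_def cones by (simp add: sum.reindex ri)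
qed

section \<open>Volumes of simplices\<close>

text \<open>The library's theorem on measures of linear images is stated for index types of class
  \<open>wellorder\<close> only; it is transferred to arbitrary finite index types along this copy.\<close>

typedef 'a enumerated = "UNIV :: 'a set" ..

instance enumerated :: (finite) finite
proof
  have "(UNIV :: 'a enumerated set) = range Abs_enumerated"
    by (metis Rep_enumerated_inverse surj_def)
  then show "finite (UNIV :: 'a enumerated set)" by (metis finite_imageI finite)
qed

definition enum_index :: "'a :: finite enumerated \<Rightarrow> nat" where
  "enum_index a = to_nat (Rep_enumerated a)"

lemma inj_enum_index: "enum_index a = enum_index b \<Longrightarrow> a = b"
  by (simp add: enum_index_def Rep_enumerated_inject)

instantiation enumerated :: (finite) wellorder
begin

definition less_eq_enumerated :: "'a enumerated \<Rightarrow> 'a enumerated \<Rightarrow> bool" where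
  "a \<le> b \<longleftrightarrow> enum_index a \<le> enum_index b"

definition less_enumerated :: "'a enumerated \<Rightarrow> 'a enumerated \<Rightarrow> bool" where
  "a < b \<longleftrightarrow> enum_index a < enum_index b"

instance
proof
  fix P :: "'a enumerated \<Rightarrow> bool" and a
  assume "\<And>x. (\<And>y. y < x \<Longrightarrow> P y) \<Longrightarrow> P x"
  then show "P a"
    unfolding less_enumerated_def by (induction a rule: measure_induct_rule [of enum_index]) blast
qed (auto simp: less_eq_enumerated_def less_enumerated_def inj_enum_index)

end

lemma bij_Rep_enumerated: "bij Rep_enumerated"
  by (metis Abs_enumerated_inverse Rep_enumerated_inverse UNIV_I bij_betw_byWitness subset_UNIV)

text \<open>Conjugation by \<open>h\<close> is a sign-preserving bijection between the permutations
  in the two Leibniz sums.\<close>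

lemma det_reindex:
  fixes A :: "'a :: comm_ring_1 ^ 'n ^ 'n" and h :: "'m :: finite \<Rightarrow> 'n"
  assumes h: "bij h"
  shows "det (\<chi> i j. A $ h i $ h j) = det A"
  unfolding det_def
proof (rule sum.reindex_bij_witness [where i = "map_permutation UNIV (inv h)" and j = "map_permutation UNIV h"])
  have inj: "inj h" using h by (simp add: bij_is_inj)
  fix p :: "'m \<Rightarrow> 'm" assume "p \<in> {p. p permutes UNIV}"
  then have p: "p permutes UNIV" by simp
  show "map_permutation UNIV (inv h) (map_permutation UNIV h p) = p"
    using map_permutation_compose_inv [OF h p] inj by simp
  show "map_permutation UNIV h p \<in> {p. p permutes UNIV}"
    using map_permutation_permutes [OF h p] by simp
  have "(\<Prod>i\<in>UNIV. A $ i $ map_permutation UNIV h p i)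
      = (\<Prod>i\<in>UNIV. A $ h i $ map_permutation UNIV h p (h i))"
    by (rule prod.reindex_bij_betw [OF h, symmetric])
  then show "of_int (sign (map_permutation UNIV h p)) * (\<Prod>i\<in>UNIV. A $ i $ map_permutation UNIV h p i)
      = of_int (sign p) * (\<Prod>i\<in>UNIV. (\<chi> i j. A $ h i $ h j) $ i $ p i)"
    using sign_map_permutation [OF inj p] map_permutation_apply [OF inj] by simp
next
  have bi: "bij (inv h)" using h by (simp add: bij_imp_bij_inv)
  fix p :: "'n \<Rightarrow> 'n" assume "p \<in> {p. p permutes UNIV}"
  then have p: "p permutes UNIV" by simp
  show "map_permutation UNIV h (map_permutation UNIV (inv h) p) = p"
    using map_permutation_compose_inv [OF bi p] h by (simp add: bij_is_surj surj_f_inv_f)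
  show "map_permutation UNIV (inv h) p \<in> {p. p permutes UNIV}"
    using map_permutation_permutes [OF bi p] by simp
qed

lemma prod_Basis_cart: "(\<Prod>b\<in>(Basis :: (real ^ 'n) set). f b) = (\<Prod>i\<in>UNIV. f (axis i 1))"
proof -
  have B: "(Basis :: (real ^ 'n) set) = range (\<lambda>i. axis i 1)" by (auto simp: Basis_vec_def)
  have "inj (\<lambda>i :: 'n. axis i (1 :: real))" by (simp add: inj_def axis_eq_axis)
  then show ?thesis unfolding B by (subst prod.reindex) (simp_all add: o_def)
qed

lemma sum_Basis_cart: "(\<Sum>b\<in>(Basis :: (real ^ 'n) set). f b) = (\<Sum>i\<in>UNIV. f (axis i 1))"
proof -
  have B: "(Basis :: (real ^ 'n) set) = range (\<lambda>i. axis i 1)" by (auto simp: Basis_vec_def)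
  have "inj (\<lambda>i :: 'n. axis i (1 :: real))" by (simp add: inj_def axis_eq_axis)
  then show ?thesis unfolding B by (subst sum.reindex) (simp_all add: o_def)
qed

lemma linear_reindex: "linear (\<lambda>x :: real ^ 'n. \<chi> i. x $ h i)"
  by (simp add: linear_iff vec_eq_iff)

lemma continuous_on_reindex: "continuous_on A (\<lambda>x :: real ^ 'n. \<chi> i. x $ h i)"
  by (rule linear_continuous_on [OF linear_conv_bounded_linear [THEN iffD1, OF linear_reindex]])

text \<open>Relabelling coordinates takes boxes to boxes with the same side lengths, and the values
  on boxes characterize Lebesgue measure.\<close>

lemma lborel_reindex:
  fixes h :: "'m :: finite \<Rightarrow> 'n :: finite"
  assumes h: "bij h"
  shows "distr lborel borel (\<lambda>x :: real ^ 'n. \<chi> i. x $ h i) = (lborel :: (real ^ 'm) measure)"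
proof (rule lborel_eqI [symmetric])
  let ?T = "\<lambda>x :: real ^ 'n. (\<chi> i. x $ h i) :: real ^ 'm"
  have meas: "?T \<in> borel_measurable lborel"
    using borel_measurable_continuous_onI [OF continuous_on_reindex] by simp
  fix l u :: "real ^ 'm" assume le: "\<And>b. b \<in> Basis \<Longrightarrow> l \<bullet> b \<le> u \<bullet> b"
  have le': "l $ i \<le> u $ i" for i using le [of "axis i 1"] by (simp add: inner_axis axis_in_Basis_iff)
  let ?l = "(\<chi> k. l $ inv h k) :: real ^ 'n" and ?u = "(\<chi> k. u $ inv h k) :: real ^ 'n"
  have inv: "inv h (h i) = i" "h (inv h k) = k" for i k
    using h by (simp_all add: bij_is_inj bij_is_surj surj_f_inv_f)
  have "?T -` box l u = box ?l ?u"
    by (auto simp: mem_box_cart) (metis inv)+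
  then have "emeasure (distr lborel borel ?T) (box l u) = emeasure lborel (box ?l ?u)"
    using meas by (simp add: emeasure_distr)
  also have "\<dots> = (\<Prod>b\<in>Basis. (?u - ?l) \<bullet> b)"
    using le' by (intro emeasure_lborel_box) (auto simp: Basis_vec_def inner_axis)
  also have "(\<Prod>b\<in>Basis. (?u - ?l) \<bullet> b) = (\<Prod>k\<in>UNIV. (u - l) $ inv h k)"
    by (simp add: prod_Basis_cart inner_axis)
  also have "\<dots> = (\<Prod>i\<in>UNIV. (u - l) $ i)"
    by (rule prod.reindex_bij_betw) (simp add: h bij_imp_bij_inv)
  also have "\<dots> = (\<Prod>b\<in>Basis. (u - l) \<bullet> b)"
    by (simp add: prod_Basis_cart inner_axis)
  finally show "emeasure (distr lborel borel ?T) (box l u) = (\<Prod>b\<in>Basis. (u - l) \<bullet> b)" by simp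
qed simp

lemma measure_reindex_compact:
  fixes h :: "'m :: finite \<Rightarrow> 'n :: finite" and S :: "(real ^ 'n) set"
  assumes h: "bij h" and S: "compact S"
  shows "compact ((\<lambda>x. \<chi> i. x $ h i :: real ^ 'm) ` S)"
    and "measure lebesgue ((\<lambda>x. \<chi> i. x $ h i :: real ^ 'm) ` S) = measure lebesgue S"
proof -
  let ?T = "\<lambda>x :: real ^ 'n. (\<chi> i. x $ h i) :: real ^ 'm"
  show c: "compact (?T ` S)" using continuous_on_reindex S by (rule compact_continuous_image)
  have "inj ?T"
    using h by (auto simp: inj_def vec_eq_iff) (metis bij_pointE)
  then have "?T -` ?T ` S = S" by (simp add: inj_vimage_image_eq)
  moreover have "?T \<in> borel_measurable lborel"
    using borel_measurable_continuous_onI [OF continuous_on_reindex] by simp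
  moreover have "?T ` S \<in> sets borel" using c by (simp add: borel_compact)
  ultimately have "measure (distr lborel borel ?T) (?T ` S) = measure lborel S"
    by (simp add: measure_distr)
  then show "measure lebesgue (?T ` S) = measure lebesgue S"
    using c S by (simp add: lborel_reindex [OF h] borel_compact)
qed

lemma measure_linear_image_compact:
  fixes f :: "real ^ 'n \<Rightarrow> real ^ 'n"
  assumes f: "linear f" and S: "compact S"
  shows "measure lebesgue (f ` S) = \<bar>det (matrix f)\<bar> * measure lebesgue S"
proof -
  let ?h = "Rep_enumerated :: 'n enumerated \<Rightarrow> 'n"
  let ?T = "\<lambda>x :: real ^ 'n. (\<chi> i. x $ ?h i) :: real ^ 'n enumerated"
  let ?T' = "\<lambda>y :: real ^ 'n enumerated. (\<chi> k. y $ inv ?h k) :: real ^ 'n"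
  have h: "bij ?h" by (rule bij_Rep_enumerated)
  have inv: "inv ?h (?h i) = i" "?h (inv ?h k) = k" for i k
    using h by (simp_all add: bij_is_inj bij_is_surj surj_f_inv_f)
  have T: "?T' (?T x) = x" for x by (simp add: inv)
  \<comment> \<open>\<open>g\<close> is \<open>f\<close> in relabelled coordinates; its matrix is
    that of \<open>f\<close> with rows and columns renamed alike.\<close>
  define g where "g = ?T \<circ> f \<circ> ?T'"
  have g: "linear g" unfolding g_def by (intro linear_compose linear_reindex f)
  have "?T' (axis j 1) = axis (?h j) 1" for j by (auto simp: axis_def vec_eq_iff inv)
  then have "matrix g = (\<chi> i j. matrix f $ ?h i $ ?h j)"
    by (simp add: matrix_def g_def vec_eq_iff)
  then have det: "det (matrix g) = det (matrix f)" by (simp add: det_reindex [OF h])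
  have fS: "compact (f ` S)"
    using f S by (intro compact_continuous_image linear_continuous_on) (simp add: linear_conv_bounded_linear)
  have "measure lebesgue (f ` S) = measure lebesgue (?T ` (f ` S))"
    by (rule measure_reindex_compact(2) [OF h fS, symmetric])
  also have "?T ` (f ` S) = g ` (?T ` S)" by (simp add: g_def image_comp o_def inv)
  also have "measure lebesgue (g ` (?T ` S)) = \<bar>det (matrix g)\<bar> * measure lebesgue (?T ` S)"
    by (intro measure_linear_image g lmeasurable_compact measure_reindex_compact(1) h S)
  also have "\<dots> = \<bar>det (matrix f)\<bar> * measure lebesgue S"
    by (simp add: det measure_reindex_compact(2) [OF h S])
  finally show ?thesis .
qed

text \<open>For a basis of rows and positive \<open>s\<close>, the simplex with vertices 0 and
  \<open>row j U\<close> divided by \<open>s j\<close>. The products \<open>c j * s j\<close> are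
  the barycentric coordinates at the nonzero vertices.\<close>

definition row_simplex :: "real ^ 'd ^ 'n \<Rightarrow> ('n \<Rightarrow> real) \<Rightarrow> 'n set \<Rightarrow> (real ^ 'd) set" where
  "row_simplex U s J = {\<Sum>j\<in>J. c j *\<^sub>R row j U | c. (\<forall>j\<in>J. 0 \<le> c j) \<and> (\<Sum>j\<in>J. c j * s j) \<le> 1}"

lemma measure_row_simplex:
  fixes U :: "real ^ 'd ^ 'n"
  assumes card: "card J = CARD('d)" and s: "\<And>j. j \<in> J \<Longrightarrow> 0 < s j"
  shows "row_simplex U s J \<in> lmeasurable"
    and "measure lebesgue (row_simplex U s J) = abs_det_rows U J / (fact CARD('d) * (\<Prod>j\<in>J. s j))"
proof -
  \<comment> \<open>The same choice as in \<open>abs_det_rows\<close>, so the determinants agree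
    literally.\<close>
  define f where "f = (SOME f :: 'd \<Rightarrow> 'n. bij_betw f UNIV J)"
  have "\<exists>f :: 'd \<Rightarrow> 'n. bij_betw f UNIV J" using card by (intro finite_same_card_bij) auto
  then have f: "bij_betw f UNIV J" unfolding f_def by (rule someI_ex)
  then have fJ: "f k \<in> J" for k by (auto simp: bij_betw_def)
  define A :: "real ^ 'd ^ 'd" where "A = (\<chi> k. row (f k) U)"
  have A: "abs_det_rows U J = \<bar>det A\<bar>" by (simp add: abs_det_rows_def A_def f_def)
  \<comment> \<open>\<open>g\<close> sends the basis vector at \<open>k\<close> to
    \<open>row (f k) U\<close> divided by \<open>s (f k)\<close>, hence the standard simplex of
    volume \<open>1 / fact CARD('d)\<close> onto the row simplex.\<close>
  define g where "g x = (\<Sum>k\<in>UNIV. (x $ k / s (f k)) *\<^sub>R row (f k) U)" for x :: "real ^ 'd"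
  have g: "linear g"
    by (auto simp: linear_iff g_def sum.distrib [symmetric] scaleR_sum_right algebra_simps add_divide_distrib
        intro!: sum.cong)
  have "g (axis j 1) = (1 / s (f j)) *\<^sub>R row (f j) U" for j
  proof -
    have "g (axis j 1) = (\<Sum>k\<in>UNIV. if k = j then (1 / s (f j)) *\<^sub>R row (f j) U else 0)"
      unfolding g_def by (intro sum.cong) (auto simp: axis_def)
    then show ?thesis by simp
  qed
  then have "matrix g = transpose (\<chi> k. (1 / s (f k)) *s row (f k) U)"
    by (simp add: matrix_def transpose_def vec_eq_iff)
  then have "det (matrix g) = (\<Prod>k\<in>UNIV. 1 / s (f k)) * det A"
    by (simp add: det_rows_mul A_def)
  also have "(\<Prod>k\<in>UNIV. 1 / s (f k)) = (\<Prod>j\<in>J. 1 / s j)"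
    by (rule prod.reindex_bij_betw [OF f])
  finally have "det (matrix g) = det A / (\<Prod>j\<in>J. s j)" by (simp add: prod_dividef)
  moreover have "0 < (\<Prod>j\<in>J. s j)" using s by (simp add: prod_pos)
  ultimately have det: "\<bar>det (matrix g)\<bar> = abs_det_rows U J / (\<Prod>j\<in>J. s j)" by (simp add: A)
  let ?\<Delta> = "convex hull (insert 0 Basis) :: (real ^ 'd) set"
  have \<Delta>: "?\<Delta> = {x. (\<forall>k. 0 \<le> x $ k) \<and> (\<Sum>k\<in>UNIV. x $ k) \<le> 1}"
    unfolding std_simplex sum_Basis_cart by (auto simp: Basis_vec_def inner_axis)
  have compact: "compact ?\<Delta>" by (intro finite_imp_compact_convex_hull) auto
  have sumJ: "(\<Sum>k\<in>UNIV. F (f k)) = sum F J" for F :: "'n \<Rightarrow> 'b :: comm_monoid_add"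
    by (rule sum.reindex_bij_betw [OF f])
  have image: "g ` ?\<Delta> = row_simplex U s J"
  proof (intro equalityI subsetI)
    fix u assume "u \<in> g ` ?\<Delta>"
    then obtain x where x: "\<And>k. 0 \<le> x $ k" "(\<Sum>k\<in>UNIV. x $ k) \<le> 1" "u = g x" by (auto simp: \<Delta>)
    define c where "c j = x $ inv f j / s j" for j
    have "inj f" using f by (simp add: bij_betw_def)
    then have c: "c (f k) = x $ k / s (f k)" for k by (simp add: c_def)
    have "u = (\<Sum>j\<in>J. c j *\<^sub>R row j U)" unfolding x(3) g_def sumJ [symmetric] c ..
    moreover have "(\<Sum>j\<in>J. c j * s j) = (\<Sum>k\<in>UNIV. x $ k)"
      unfolding sumJ [symmetric] c using s [OF fJ] by (intro sum.cong) (auto simp: less_imp_neq [symmetric])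
    moreover have "\<forall>j\<in>J. 0 \<le> c j" using x(1) s by (simp add: c_def less_imp_le)
    ultimately show "u \<in> row_simplex U s J" using x(2) by (auto simp: row_simplex_def)
  next
    fix u assume "u \<in> row_simplex U s J"
    then obtain c where c: "u = (\<Sum>j\<in>J. c j *\<^sub>R row j U)" "\<forall>j\<in>J. 0 \<le> c j" "(\<Sum>j\<in>J. c j * s j) \<le> 1"
      by (auto simp: row_simplex_def)
    define x :: "real ^ 'd" where "x = (\<chi> k. c (f k) * s (f k))"
    have "x \<in> ?\<Delta>"
      using c fJ s sumJ [of "\<lambda>j. c j * s j"] by (simp add: \<Delta> x_def less_imp_le)
    moreover have "u = g x"
      unfolding c(1) g_def sumJ [symmetric] x_def using s [OF fJ]
      by (intro sum.cong) (auto simp: less_imp_neq [symmetric])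
    ultimately show "u \<in> g ` ?\<Delta>" by blast
  qed
  have "compact (g ` ?\<Delta>)"
    using g compact by (intro compact_continuous_image linear_continuous_on) (simp_all add: linear_conv_bounded_linear)
  then show "row_simplex U s J \<in> lmeasurable" by (simp add: image lmeasurable_compact)
  have "measure lebesgue ?\<Delta> = 1 / fact CARD('d)"
    using content_std_simplex [where 'a = "real ^ 'd"] compact by (simp add: borel_compact)
  then show "measure lebesgue (row_simplex U s J) = abs_det_rows U J / (fact CARD('d) * (\<Prod>j\<in>J. s j))"
    using measure_linear_image_compact [OF g compact] by (simp add: det image)
qed

section \<open>Volume of the polar dual\<close>

text \<open>A functional in the polar dual is bounded below and attains its minimum at a vertex
  \<open>v\<close>, so it is a conic combination of the rows tight at \<open>v\<close>. Its drop
  from \<open>y\<close> to \<open>v\<close> is the weighted slack at \<open>y\<close>, and the polar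
  condition bounds this drop by 1.\<close>

lemma polar_dual_polyhedron:
  fixes U :: "real ^ 'd ^ 'n"
  assumes full: "spanning U UNIV" and y: "y \<in> polyhedron_of U x"
  shows "polar_dual {y' - y | y'. y' \<in> polyhedron_of U x}
    = (\<Union>J\<in>vertex_sets U x. row_simplex U (slack U x y) J)"
proof (intro equalityI subsetI)
  fix u assume u: "u \<in> polar_dual {y' - y | y'. y' \<in> polyhedron_of U x}"
  have bdd: "u \<bullet> y - 1 \<le> u \<bullet> y'" if "y' \<in> polyhedron_of U x" for y'
  proof -
    have "- 1 \<le> u \<bullet> (y' - y)" using u that unfolding polar_dual_def by blast
    then show ?thesis by (simp add: inner_diff_right)
  qed
  obtain v where v: "v \<in> polyhedron_of U x" "spanning U (tight U x v)"
    "\<And>y'. y' \<in> polyhedron_of U x \<Longrightarrow> u \<bullet> v \<le> u \<bullet> y'"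
    using ex_vertex_minimizer [OF full _ bdd] y by blast
  then obtain c where c: "u = (\<Sum>j\<in>tight U x v. c j *\<^sub>R row j U)" "\<forall>j\<in>tight U x v. 0 \<le> c j"
    using minimizer_iff_cone_rows [OF v(1), of u] by (auto simp: cone_rows_eq)
  have "(\<Sum>j\<in>tight U x v. c j * slack U x v j) = 0" by (simp add: tight_def)
  then have "(\<Sum>j\<in>tight U x v. c j * slack U x y j) \<le> 1"
    using bdd [OF v(1)] unfolding c(1) inner_cone_rows [of _ _ _ _ x] by simp
  then have "u \<in> row_simplex U (slack U x y) (tight U x v)" using c by (auto simp: row_simplex_def)
  then show "u \<in> (\<Union>J\<in>vertex_sets U x. row_simplex U (slack U x y) J)"
    using v by (auto simp: vertex_sets_def)
next
  fix u assume "u \<in> (\<Union>J\<in>vertex_sets U x. row_simplex U (slack U x y) J)"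
  then obtain J c where c: "u = (\<Sum>j\<in>J. c j *\<^sub>R row j U)" "\<forall>j\<in>J. 0 \<le> c j"
    "(\<Sum>j\<in>J. c j * slack U x y j) \<le> 1" by (auto simp: row_simplex_def)
  have "- 1 \<le> u \<bullet> (y' - y)" if "y' \<in> polyhedron_of U x" for y'
  proof -
    have "0 \<le> (\<Sum>j\<in>J. c j * slack U x y' j)"
      using c(2) that by (intro sum_nonneg) (auto simp: mem_polyhedron_of)
    then show ?thesis
      using c(3) unfolding c(1) inner_diff_right inner_cone_rows [of _ _ _ _ x] by simp
  qed
  then show "u \<in> polar_dual {y' - y | y'. y' \<in> polyhedron_of U x}"
    unfolding polar_dual_def by blast
qed

text \<open>A functional in the interior of the cone at one vertex is minimised at that vertex only, so
  two of the cones can meet only in their boundaries.\<close>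

lemma negligible_row_simplex_Int:
  fixes U :: "real ^ 'd ^ 'n"
  assumes J: "J \<in> vertex_sets U x" "indep_rows U J" and K: "K \<in> vertex_sets U x" and ne: "J \<noteq> K"
  shows "negligible (row_simplex U s J \<inter> row_simplex U s K)"
proof -
  obtain v where v: "v \<in> polyhedron_of U x" "spanning U J" "J = tight U x v"
    using J(1) by (auto simp: vertex_sets_def)
  obtain w where w: "w \<in> polyhedron_of U x" "K = tight U x w"
    using K by (auto simp: vertex_sets_def)
  \<comment> \<open>The spans of the facets of the cone over \<open>J\<close> that pass through the
    origin; each has dimension one less than the space.\<close>
  have "negligible (\<Union>j\<in>J. span ((\<lambda>j. row j U) ` (J - {j})))"
  proof (intro negligible_Union, goal_cases)
    case (2 S)
    then obtain j where j: "j \<in> J" "S = span ((\<lambda>j. row j U) ` (J - {j}))" by blast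
    have "dim (span ((\<lambda>j. row j U) ` (J - {j}))) = card (J - {j})"
      using card_indep_rows [OF indep_rows_subset [OF J(2), of "J - {j}"]] by simp
    also have "\<dots> < card J" using j by (intro psubset_card_mono) auto
    finally show "negligible S"
      using card_basis_rows [OF J(2) v(2)] unfolding j(2) by (intro negligible_lowdim) simp
  qed simp
  moreover have "row_simplex U s J \<inter> row_simplex U s K \<subseteq> (\<Union>j\<in>J. span ((\<lambda>j. row j U) ` (J - {j})))"
  proof
    fix u assume u: "u \<in> row_simplex U s J \<inter> row_simplex U s K"
    then have "u \<in> cone_rows U K" by (auto simp: row_simplex_def cone_rows_eq)
    then have "\<forall>y\<in>polyhedron_of U x. u \<bullet> w \<le> u \<bullet> y" using minimizer_iff_cone_rows [OF w(1), of u] w(2) by simp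
    then have le: "u \<bullet> w \<le> u \<bullet> v" using v by blast
    obtain c where c: "u = (\<Sum>j\<in>J. c j *\<^sub>R row j U)" "\<forall>j\<in>J. 0 \<le> c j" using u by (auto simp: row_simplex_def)
    \<comment> \<open>With all coefficients positive, minimality at \<open>w\<close> would make
      every constraint in \<open>J\<close> tight at \<open>w\<close>, so that \<open>w\<close> would
      be \<open>v\<close>.\<close>
    have "\<exists>j\<in>J. c j = 0"
    proof (rule ccontr)
      assume "\<not> (\<exists>j\<in>J. c j = 0)"
      then have pos: "\<forall>j\<in>J. 0 < c j" using c(2) by (simp add: order_less_le)
      have "(\<Sum>j\<in>J. c j * slack U x v j) = 0" by (simp add: v(3) tight_def)
      then have "(\<Sum>j\<in>J. c j * slack U x w j) \<le> 0"
        using le unfolding c(1) inner_cone_rows [of _ _ _ _ x] by simp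
      moreover have nn: "\<forall>j\<in>J. 0 \<le> c j * slack U x w j" using c(2) w(1) by (simp add: mem_polyhedron_of)
      ultimately have "(\<Sum>j\<in>J. c j * slack U x w j) = 0" by (meson antisym sum_nonneg)
      then have "\<forall>j\<in>J. slack U x w j = 0" using nn pos by (force simp: sum_nonneg_eq_0_iff)
      then have "J \<subseteq> tight U x w" by (auto simp: tight_def)
      then have "v = w" using vertex_eqI [OF v(2)] v(3) by blast
      then show False using ne v(3) w(2) by simp
    qed
    then obtain j where j: "j \<in> J" "c j = 0" by blast
    then have "u = (\<Sum>k\<in>J - {j}. c k *\<^sub>R row k U)" unfolding c(1) by (simp add: sum.remove)
    also have "\<dots> \<in> span ((\<lambda>j. row j U) ` (J - {j}))"
      by (intro span_sum span_scale span_base) auto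
    finally show "u \<in> (\<Union>j\<in>J. span ((\<lambda>j. row j U) ` (J - {j})))" using j(1) by blast
  qed
  ultimately show ?thesis by (rule negligible_subset)
qed

section \<open>Interior points, total volume and uniqueness of the adjoint\<close>

lemma slack_pos_interior:
  fixes U :: "real ^ 'd ^ 'n"
  assumes "y \<in> interior (polyhedron_of U x)" "row i U \<noteq> 0"
  shows "0 < slack U x y i"
proof -
  obtain t where t: "0 < t" "y + t *\<^sub>R (- row i U) \<in> polyhedron_of U x"
    using interior_step [OF assms(1)] .
  then have "0 \<le> slack U x y i - t * (row i U \<bullet> row i U)"
    unfolding mem_polyhedron_of slack_add_scaleR by (auto dest: spec [of _ i])
  moreover have "0 < t * (row i U \<bullet> row i U)" using t(1) assms(2) by simp
  ultimately show ?thesis by linarith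
qed

lemma interior_polyhedron_nonempty:
  fixes U :: "real ^ 'd ^ 'n"
  assumes "y \<in> polyhedron_of U x" "tight U x y = {}"
  shows "interior (polyhedron_of U x) \<noteq> {}"
proof -
  let ?S = "\<Inter>i. {y. - x $ i < row i U \<bullet> y}"
  have "open ?S" by (intro open_INT open_halfspace_gt ballI) simp
  moreover have "?S \<subseteq> polyhedron_of U x"
    by (auto simp: mem_polyhedron_of slack_def) (smt (verit) INT_E UNIV_I mem_Collect_eq)
  moreover have "y \<in> ?S"
  proof (clarify)
    fix i
    have "0 \<le> slack U x y i" "slack U x y i \<noteq> 0" using assms by (auto simp: mem_polyhedron_of tight_def)
    then show "- x $ i < row i U \<bullet> y" by (simp add: slack_def)
  qed
  ultimately show ?thesis using interior_maximal by blast
qed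

lemma normalized_volume_polar_dual:
  fixes U :: "real ^ 'd ^ 'n"
  assumes full: "spanning U UNIV" and ind: "\<And>J. J \<in> vertex_sets U x \<Longrightarrow> indep_rows U J"
    and y: "\<And>i. 0 < slack U x y i"
  shows "normalized_volume (polar_dual {y' - y | y'. y' \<in> polyhedron_of U x})
    = (\<Sum>J\<in>vertex_sets U x. abs_det_rows U J * (\<Prod>i\<in>- J. slack U x y i)) / (\<Prod>i\<in>UNIV. slack U x y i)"
proof -
  let ?V = "vertex_sets U x" and ?s = "slack U x y"
  have card: "card J = CARD('d)" if "J \<in> ?V" for J
    using card_basis_rows [OF ind [OF that]] that by (auto simp: vertex_sets_def)
  have "y \<in> polyhedron_of U x" using y by (simp add: mem_polyhedron_of less_imp_le)
  then have "normalized_volume (polar_dual {y' - y | y'. y' \<in> polyhedron_of U x})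
      = fact CARD('d) * measure lebesgue (\<Union>(row_simplex U ?s ` ?V))"
    by (simp only: normalized_volume_def polar_dual_polyhedron [OF full])
  also have "measure lebesgue (\<Union>(row_simplex U ?s ` ?V)) = (\<Sum>J\<in>?V. measure lebesgue (row_simplex U ?s J))"
    using card y ind by (intro measure_negligible_finite_Union_image)
      (auto simp: pairwise_def intro: measure_row_simplex(1) negligible_row_simplex_Int)
  also have "\<dots> = (\<Sum>J\<in>?V. abs_det_rows U J / (fact CARD('d) * (\<Prod>j\<in>J. ?s j)))"
    using card y by (intro sum.cong measure_row_simplex(2)) auto
  also have "fact CARD('d) * \<dots> = (\<Sum>J\<in>?V. abs_det_rows U J * (\<Prod>i\<in>- J. ?s i) / (\<Prod>i\<in>UNIV. ?s i))"
    unfolding sum_distrib_left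
  proof (intro sum.cong refl)
    fix J assume "J \<in> ?V"
    \<comment> \<open>Expanding by the slacks outside \<open>J\<close> brings every simplex volume
      to the common denominator.\<close>
    have "(\<Prod>i\<in>UNIV. ?s i) = (\<Prod>i\<in>J. ?s i) * (\<Prod>i\<in>- J. ?s i)"
      by (subst prod.union_disjoint [symmetric]) (auto simp: Compl_partition)
    moreover have "(\<Prod>i\<in>J. ?s i) \<noteq> 0" "(\<Prod>i\<in>- J. ?s i) \<noteq> 0"
      using y by (auto simp: less_imp_neq [symmetric])
    ultimately show "fact CARD('d) * (abs_det_rows U J / (fact CARD('d) * (\<Prod>j\<in>J. ?s j)))
        = abs_det_rows U J * (\<Prod>i\<in>- J. ?s i) / (\<Prod>i\<in>UNIV. ?s i)"
      by simp
  qed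
  finally show ?thesis by (simp add: sum_divide_distrib)
qed

text \<open>On the line from a point of \<open>S\<close> to \<open>x\<close>, the difference is a
  univariate polynomial with infinitely many roots near 0. It is therefore zero, in particular at
  parameter 1, which is \<open>x\<close>.\<close>

lemma real_polynomial_function_eq_on_open:
  fixes p q :: "'a :: real_normed_vector \<Rightarrow> real"
  assumes p: "real_polynomial_function p" and q: "real_polynomial_function q"
    and S: "open S" "S \<noteq> {}" and eq: "\<And>y. y \<in> S \<Longrightarrow> p y = q y"
  shows "p = q"
proof
  fix x
  obtain y where y: "y \<in> S" using S(2) by blast
  let ?l = "\<lambda>t :: real. y + t *\<^sub>R (x - y)"
  have l: "polynomial_function ?l"
    by (intro polynomial_function_add polynomial_function_const polynomial_function_mult polynomial_function_id)
  have "real_polynomial_function ((\<lambda>w. p w - q w) \<circ> ?l)"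
    using l p q by blast
  then obtain a n where "(\<lambda>w. p w - q w) \<circ> ?l = (\<lambda>t. \<Sum>i\<le>n. a i * t ^ i)"
    using real_polynomial_function_iff_sum by blast
  then have a: "p (?l t) - q (?l t) = (\<Sum>i\<le>n. a i * t ^ i)" for t by (simp add: fun_eq_iff)
  have "continuous_on UNIV ?l" by (intro continuous_intros)
  then have "open (?l -` S)" using S(1) by (simp add: open_vimage)
  moreover have "0 \<in> ?l -` S" using y by simp
  ultimately have "infinite (?l -` S)"
    using finite_imp_not_open by blast
  moreover have "?l -` S \<subseteq> {t. (\<Sum>i\<le>n. a i * t ^ i) = 0}"
    using eq by (auto simp: a [symmetric])
  ultimately have "infinite {t. (\<Sum>i\<le>n. a i * t ^ i) = 0}" using finite_subset by blast
  then have "\<forall>i\<le>n. a i = 0" by (simp add: polyfun_finite_roots)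
  then show "p x = q x" using a [of 1] by simp
qed

theorem lemma4p4:
  fixes U :: "real ^ 'd ^ 'n" and C :: "(real ^ 'n) set" and z :: "real ^ 'n"
  assumes "rank U = CARD('d)"
    and "C \<in> chamber_complex U"
    and "aff_dim C = int CARD('n)"
    and "ray_matrix U (fan_of_chamber U C)"
    and "z \<in> interior C"
  shows "(\<lambda>y. universal_adjoint U (fan_of_chamber U C) (U *v y + z)) = adjoint_polynomial U z"
proof -
  obtain x0 where C: "C = chamber U x0" using assms(2) by (auto simp: chamber_complex_def)
  have full: "spanning U UNIV" by (rule spanning_UNIV) fact
  have z: "z \<in> interior (chamber U x0)" using assms(5) C by simp
  let ?P = "polyhedron_of U z" and ?V = "vertex_sets U z"
  define p where "p y = (\<Sum>J\<in>?V. abs_det_rows U J * (\<Prod>i\<in>- J. slack U z y i))" for y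
  \<comment> \<open>Independence is available for tight sets at \<open>x0\<close>; constancy of the
    vertex sets carries it over to \<open>z\<close>.\<close>
  have V: "indep_rows U J \<and> spanning U J" if "J \<in> ?V" for J
    using that indep_rows_vertex_sets_chamber [OF z]
    unfolding vertex_sets_chamber [OF full z] unfolding vertex_sets_def by blast
  have inj: "inj (row_ray U)" using assms(4) by (simp add: ray_matrix_def bij_betw_def)
  \<comment> \<open>A zero row would generate a cone of dimension 0 instead of a ray. Nonzero rows
    are what makes all slacks positive at interior points.\<close>
  have row: "row i U \<noteq> 0" for i
  proof
    assume "row i U = 0"
    then have "row_ray U i \<subseteq> {0}" by (auto simp: row_ray_eq cone_rows_singleton)
    then have "dim (row_ray U i) = 0" by simp
    moreover have "row_ray U i \<in> cones_of_dim 1 (fan_of_chamber U C)"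
      using assms(4) by (auto simp: ray_matrix_def bij_betw_def)
    ultimately show False by (simp add: cones_of_dim_def del: dim_eq_0)
  qed
  have adj: "(\<lambda>y. universal_adjoint U (fan_of_chamber U C) (U *v y + z)) = p"
  proof
    fix y
    have "universal_adjoint U (cone_rows U ` {J'. \<exists>J\<in>?V. J' \<subseteq> J}) (U *v y + z)
        = (\<Sum>J\<in>?V. abs_det_rows U J * (\<Prod>i\<in>- J. (U *v y + z) $ i))"
      by (rule universal_adjoint_cone_rows [OF inj]) (rule V)
    then show "universal_adjoint U (fan_of_chamber U C) (U *v y + z) = p y"
      by (simp only: C fan_of_chamber_eq [OF full z] slack_component p_def)
  qed
  have poly: "real_polynomial_function p"
    unfolding p_def slack_def
    by (intro real_polynomial_function_sum real_polynomial_function_prod real_polynomial_function.intros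
        bounded_linear_inner_right finite)
  have vol: "normalized_volume (polar_dual {y' - y | y'. y' \<in> ?P}) = p y / (\<Prod>i\<in>UNIV. row i U \<bullet> y + z $ i)"
    if "y \<in> interior ?P" for y
    using normalized_volume_polar_dual [OF full _ slack_pos_interior [OF that row]] V
    by (simp add: p_def slack_def)
  have "z \<in> chamber U x0" using z interior_subset by blast
  moreover from this obtain v where "v \<in> polyhedron_of U x0"
    using polyhedron_nonempty_if_chamber by blast
  ultimately have "?P \<noteq> {}" using chamber_tight by blast
  then obtain y0 where "y0 \<in> ?P" by blast
  then obtain v where "v \<in> ?P" "spanning U (tight U z v)"
    using ex_vertex_above [OF full, of y0 z 0 0] by auto
  \<comment> \<open>The empty set lies below any vertex set, so some point has no tight constraint.
    The interior is thus nonempty, and the volume formula determines the polynomial.\<close>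
  then have "{} \<in> {J'. \<exists>J\<in>?V. J' \<subseteq> J}" by (auto simp: vertex_sets_def)
  also have "\<dots> = tight U z ` ?P" using V by (simp add: tight_image_polyhedron [OF full])
  finally obtain y where "y \<in> ?P" "tight U z y = {}" by (metis imageE)
  then have int: "interior ?P \<noteq> {}" using interior_polyhedron_nonempty by blast
  have unique: "q = p" if q: "real_polynomial_function q"
    and vq: "\<forall>y\<in>interior ?P. normalized_volume (polar_dual {y' - y | y'. y' \<in> ?P})
      = q y / (\<Prod>i\<in>UNIV. row i U \<bullet> y + z $ i)" for q
  proof (rule real_polynomial_function_eq_on_open [OF q poly open_interior int])
    fix y assume y: "y \<in> interior ?P"
    let ?d = "\<Prod>i\<in>UNIV. row i U \<bullet> y + z $ i"
    have "0 < row i U \<bullet> y + z $ i" for i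
      using slack_pos_interior [OF y row] by (simp add: slack_def)
    then have "0 < ?d" by (intro prod_pos) blast
    then have "?d \<noteq> 0" by (rule less_imp_neq [symmetric])
    moreover have "q y / ?d = p y / ?d" using vq [rule_format, OF y] vol [OF y] by (rule trans [OF sym])
    ultimately show "q y = p y" unfolding divide_cancel_right by blast
  qed
  show ?thesis
    unfolding adj adjoint_polynomial_def
  proof (rule the_equality [symmetric])
    show "real_polynomial_function p \<and> (\<forall>y\<in>interior ?P. normalized_volume (polar_dual {y' - y | y'. y' \<in> ?P})
        = p y / (\<Prod>i\<in>UNIV. row i U \<bullet> y + z $ i))"
      by (intro conjI ballI poly vol)
  qed (elim conjE, rule unique)
qed

end
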